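(* Let $\mathcal{A}$ be an abelian category and $\mathcal{W}$ a subcategory of $\mathcal{A}$. Assume $\mathcal{W}\perp\mathcal{W}$. (a) If $\mathcal{W}$ is closed under kernels of epimorphisms, then so is $\mathcal{G}(\mathcal{W})$. (b) If $\mathcal{W}$ is closed under cokernels of monomorphisms, then so is $\mathcal{G}(\mathcal{W})$.
   Context: "Subcategory" means full additive subcategory closed under isomorphisms. $\mathcal{W}\perp\mathcal{W}$ means $\operatorname{Ext}^{i}_{\mathcal{A}}(W,W')=0$ for all $i\geq 1$ and all objects $W,W'\in\mathcal{W}$. An exact complex $X=\cdots\to X_1\xrightarrow{\partial^X_1}X_0\xrightarrow{\partial^X_0}X_{-1}\to\cdots$ of objects in $\mathcal{W}$ is totally $\mathcal{W}$-acyclic if $\operatorname{Hom}_{\mathcal{A}}(W,X)$ and $\operatorname{Hom}_{\mathcal{A}}(X,W)$ are exact for every object $W$ in $\mathcal{W}$. $\mathcal{G}(\mathcal{W})$ is the subcategory of objects $M\cong\operatorname{Coker}(\partial^X_1)$ for some totally $\mathcal{W}$-acyclic complex $X$. A subcategory $\mathcal{X}$ is closed under kernels of epimorphisms if the kernel of every epimorphism of $\mathcal{A}$ between objects of $\mathcal{X}$ is in $\mathcal{X}$, and closed under cokernels of monomorphisms if the cokernel of every monomorphism of $\mathcal{A}$ between objects of $\mathcal{X}$ is in $\mathcal{X}$. *)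

theory Defs
  imports "HOL-Algebra.Exact_Sequence"
begin

section \<open>Categories and preadditive categories\<close>

record ('o, 'm) cat =
  Obj :: "'o set"
  Arr :: "'m set"
  Dom :: "'m \<Rightarrow> 'o"
  Cod :: "'m \<Rightarrow> 'o"
  Idm :: "'o \<Rightarrow> 'm"
  Comp :: "'m \<Rightarrow> 'm \<Rightarrow> 'm"  (infixl \<open>\<cdot>\<index>\<close> 70)

text \<open>Composition is written in the usual order: \<open>g \<cdot> f\<close> is \<open>f\<close> followed by \<open>g\<close>.\<close>

definition Hom :: "('o, 'm, 'b) cat_scheme \<Rightarrow> 'o \<Rightarrow> 'o \<Rightarrow> 'm set"
  where "Hom C A B = {f \<in> Arr C. Dom C f = A \<and> Cod C f = B}"

locale category =
  fixes C :: "('o, 'm, 'b) cat_scheme" (structure)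
  assumes Dom_in_Obj: "f \<in> Arr C \<Longrightarrow> Dom C f \<in> Obj C"
    and Cod_in_Obj: "f \<in> Arr C \<Longrightarrow> Cod C f \<in> Obj C"
    and Idm_in_Hom: "A \<in> Obj C \<Longrightarrow> Idm C A \<in> Hom C A A"
    and Comp_in_Hom: "\<lbrakk>f \<in> Hom C A B; g \<in> Hom C B D\<rbrakk> \<Longrightarrow> g \<cdot> f \<in> Hom C A D"
    and Comp_Idm_right: "f \<in> Hom C A B \<Longrightarrow> f \<cdot> Idm C A = f"
    and Comp_Idm_left: "f \<in> Hom C A B \<Longrightarrow> Idm C B \<cdot> f = f"
    and Comp_assoc: "\<lbrakk>f \<in> Hom C A B; g \<in> Hom C B D; h \<in> Hom C D E\<rbrakk>
      \<Longrightarrow> (h \<cdot> g) \<cdot> f = h \<cdot> (g \<cdot> f)"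

record ('o, 'm) preadd_cat = "('o, 'm) cat" +
  Zero :: "'o \<Rightarrow> 'o \<Rightarrow> 'm"
  Add :: "'m \<Rightarrow> 'm \<Rightarrow> 'm"  (infixl \<open>\<oplus>\<^sub>c\<index>\<close> 65)

text \<open>The hom-sets as abelian groups; HOL-Algebra's multiplicative notation stands for addition
  of morphisms.\<close>

definition hom_group :: "('o, 'm, 'b) preadd_cat_scheme \<Rightarrow> 'o \<Rightarrow> 'o \<Rightarrow> 'm monoid"
  where "hom_group C A B = \<lparr>carrier = Hom C A B, monoid.mult = Add C, one = Zero C A B\<rparr>"

locale preadditive_category = category C
  for C :: "('o, 'm, 'b) preadd_cat_scheme" (structure) +
  assumes comm_group_Hom:
      "\<lbrakk>A \<in> Obj C; B \<in> Obj C\<rbrakk> \<Longrightarrow> comm_group (hom_group C A B)"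
    and Comp_Add_right: "\<lbrakk>f \<in> Hom C A B; f' \<in> Hom C A B; g \<in> Hom C B D\<rbrakk>
      \<Longrightarrow> g \<cdot> (f \<oplus>\<^sub>c f') = g \<cdot> f \<oplus>\<^sub>c g \<cdot> f'"
    and Comp_Add_left: "\<lbrakk>f \<in> Hom C A B; g \<in> Hom C B D; g' \<in> Hom C B D\<rbrakk>
      \<Longrightarrow> (g \<oplus>\<^sub>c g') \<cdot> f = g \<cdot> f \<oplus>\<^sub>c g' \<cdot> f"


section \<open>Abelian categories\<close>

definition is_mono :: "('o, 'm, 'b) cat_scheme \<Rightarrow> 'm \<Rightarrow> bool"
  where "is_mono C f \<longleftrightarrow> f \<in> Arr C \<and>
    (\<forall>A \<in> Obj C. \<forall>g \<in> Hom C A (Dom C f). \<forall>h \<in> Hom C A (Dom C f).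
      f \<cdot>\<^bsub>C\<^esub> g = f \<cdot>\<^bsub>C\<^esub> h \<longrightarrow> g = h)"

definition is_epi :: "('o, 'm, 'b) cat_scheme \<Rightarrow> 'm \<Rightarrow> bool"
  where "is_epi C f \<longleftrightarrow> f \<in> Arr C \<and>
    (\<forall>A \<in> Obj C. \<forall>g \<in> Hom C (Cod C f) A. \<forall>h \<in> Hom C (Cod C f) A.
      g \<cdot>\<^bsub>C\<^esub> f = h \<cdot>\<^bsub>C\<^esub> f \<longrightarrow> g = h)"

definition isomorphic :: "('o, 'm, 'b) cat_scheme \<Rightarrow> 'o \<Rightarrow> 'o \<Rightarrow> bool"
  where "isomorphic C A B \<longleftrightarrow> A \<in> Obj C \<and> B \<in> Obj C \<and>
    (\<exists>f \<in> Hom C A B. \<exists>g \<in> Hom C B A. g \<cdot>\<^bsub>C\<^esub> f = Idm C A \<and> f \<cdot>\<^bsub>C\<^esub> g = Idm C B)"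

definition is_zero_object :: "('o, 'm, 'b) cat_scheme \<Rightarrow> 'o \<Rightarrow> bool"
  where "is_zero_object C Z \<longleftrightarrow> Z \<in> Obj C \<and>
    (\<forall>A \<in> Obj C. (\<exists>!f. f \<in> Hom C A Z) \<and> (\<exists>!f. f \<in> Hom C Z A))"

definition is_biproduct ::
  "('o, 'm, 'b) preadd_cat_scheme \<Rightarrow> 'o \<Rightarrow> 'o \<Rightarrow> 'o \<Rightarrow> 'm \<Rightarrow> 'm \<Rightarrow> 'm \<Rightarrow> 'm \<Rightarrow> bool"
  where "is_biproduct C A B P i j p q \<longleftrightarrow>
    i \<in> Hom C A P \<and> j \<in> Hom C B P \<and> p \<in> Hom C P A \<and> q \<in> Hom C P B \<and>
    p \<cdot>\<^bsub>C\<^esub> i = Idm C A \<and> q \<cdot>\<^bsub>C\<^esub> j = Idm C B \<and>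
    q \<cdot>\<^bsub>C\<^esub> i = Zero C A B \<and> p \<cdot>\<^bsub>C\<^esub> j = Zero C B A \<and>
    i \<cdot>\<^bsub>C\<^esub> p \<oplus>\<^sub>c\<^bsub>C\<^esub> j \<cdot>\<^bsub>C\<^esub> q = Idm C P"

definition is_kernel :: "('o, 'm, 'b) preadd_cat_scheme \<Rightarrow> 'm \<Rightarrow> 'm \<Rightarrow> bool"
  where "is_kernel C f k \<longleftrightarrow> f \<in> Arr C \<and> k \<in> Arr C \<and> Cod C k = Dom C f \<and>
    f \<cdot>\<^bsub>C\<^esub> k = Zero C (Dom C k) (Cod C f) \<and>
    (\<forall>A \<in> Obj C. \<forall>g \<in> Hom C A (Dom C f). f \<cdot>\<^bsub>C\<^esub> g = Zero C A (Cod C f) \<longrightarrow>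
      (\<exists>!h. h \<in> Hom C A (Dom C k) \<and> k \<cdot>\<^bsub>C\<^esub> h = g))"

definition is_cokernel :: "('o, 'm, 'b) preadd_cat_scheme \<Rightarrow> 'm \<Rightarrow> 'm \<Rightarrow> bool"
  where "is_cokernel C f p \<longleftrightarrow> f \<in> Arr C \<and> p \<in> Arr C \<and> Dom C p = Cod C f \<and>
    p \<cdot>\<^bsub>C\<^esub> f = Zero C (Dom C f) (Cod C p) \<and>
    (\<forall>A \<in> Obj C. \<forall>g \<in> Hom C (Cod C f) A. g \<cdot>\<^bsub>C\<^esub> f = Zero C (Dom C f) A \<longrightarrow>
      (\<exists>!h. h \<in> Hom C (Cod C p) A \<and> h \<cdot>\<^bsub>C\<^esub> p = g))"

locale abelian_category = preadditive_category C
  for C :: "('o, 'm, 'b) preadd_cat_scheme" (structure) +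
  assumes zero_object_exists: "\<exists>Z. is_zero_object C Z"
    and biproduct_exists: "\<lbrakk>A \<in> Obj C; B \<in> Obj C\<rbrakk> \<Longrightarrow> \<exists>P i j p q. is_biproduct C A B P i j p q"
    and kernel_exists: "f \<in> Arr C \<Longrightarrow> \<exists>k. is_kernel C f k"
    and cokernel_exists: "f \<in> Arr C \<Longrightarrow> \<exists>p. is_cokernel C f p"
    and mono_normal: "is_mono C f \<Longrightarrow> \<exists>g. is_kernel C g f"
    and epi_conormal: "is_epi C f \<Longrightarrow> \<exists>g. is_cokernel C g f"

text \<open>Exactness of \<open>A \<rightarrow> B \<rightarrow> D\<close> at \<open>B\<close>: the image of \<open>f\<close>, i.e.\ the kernel \<open>k\<close> of a cokernel
  of \<open>f\<close>, is a kernel of \<open>g\<close>.\<close>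

definition exact_at :: "('o, 'm, 'b) preadd_cat_scheme \<Rightarrow> 'm \<Rightarrow> 'm \<Rightarrow> bool"
  where "exact_at C f g \<longleftrightarrow> (\<exists>p k. is_cokernel C f p \<and> is_kernel C p k \<and> is_kernel C g k)"


section \<open>Yoneda Ext\<close>

text \<open>The exact sequence \<open>0 \<rightarrow> B \<rightarrow> E\<^sub>n \<rightarrow> \<dots> \<rightarrow> E\<^sub>1 \<rightarrow> A \<rightarrow> 0\<close> is represented by the list of its
  \<open>n + 1\<close> morphisms between \<open>B\<close> and \<open>A\<close>. This is meant for \<open>n \<ge> 1\<close>.\<close>

definition extensions :: "('o, 'm, 'b) preadd_cat_scheme \<Rightarrow> nat \<Rightarrow> 'o \<Rightarrow> 'o \<Rightarrow> 'm list set"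
  where "extensions C n A B = {e. length e = Suc n \<and> set e \<subseteq> Arr C \<and>
    Dom C (e ! 0) = B \<and> Cod C (e ! n) = A \<and> is_mono C (e ! 0) \<and> is_epi C (e ! n) \<and>
    (\<forall>i < n. exact_at C (e ! i) (e ! Suc i))}"

text \<open>Pairs of extensions joined by a morphism of exact sequences (with vertical maps
  \<open>h 0, \<dots>, h (n + 1)\<close>) that is the identity on \<open>B\<close> and on \<open>A\<close>.\<close>

definition extension_morphism ::
  "('o, 'm, 'b) preadd_cat_scheme \<Rightarrow> nat \<Rightarrow> 'o \<Rightarrow> 'o \<Rightarrow> ('m list \<times> 'm list) set"
  where "extension_morphism C n A B = {(e, e'). e \<in> extensions C n A B \<and> e' \<in> extensions C n A B \<and>
    (\<exists>h. h 0 = Idm C B \<and> h (Suc n) = Idm C A \<and>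
      (\<forall>i \<le> n. h i \<in> Hom C (Dom C (e ! i)) (Dom C (e' ! i)) \<and>
               h (Suc i) \<cdot>\<^bsub>C\<^esub> (e ! i) = (e' ! i) \<cdot>\<^bsub>C\<^esub> h i))}"

definition Ext :: "('o, 'm, 'b) preadd_cat_scheme \<Rightarrow> nat \<Rightarrow> 'o \<Rightarrow> 'o \<Rightarrow> 'm list set set"
  where "Ext C n A B = extensions C n A B //
    (extension_morphism C n A B \<union> (extension_morphism C n A B)\<inverse>)\<^sup>*"

text \<open>\<open>Ext\<^sup>n(A, B) = 0\<close> says that this group is the trivial one, so its Baer sum
  need not be introduced.\<close>

definition Ext_vanishes :: "('o, 'm, 'b) preadd_cat_scheme \<Rightarrow> nat \<Rightarrow> 'o \<Rightarrow> 'o \<Rightarrow> bool"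
  where "Ext_vanishes C n A B \<longleftrightarrow> is_singleton (Ext C n A B)"

definition Ext_orthogonal :: "('o, 'm, 'b) preadd_cat_scheme \<Rightarrow> 'o set \<Rightarrow> 'o set \<Rightarrow> bool"
  where "Ext_orthogonal C V W \<longleftrightarrow> (\<forall>n \<ge> 1. \<forall>A \<in> V. \<forall>B \<in> W. Ext_vanishes C n A B)"


section \<open>Subcategories and totally acyclic complexes\<close>

text \<open>Full additive subcategories closed under isomorphisms, given by their classes of objects.\<close>

definition subcategory :: "('o, 'm, 'b) preadd_cat_scheme \<Rightarrow> 'o set \<Rightarrow> bool"
  where "subcategory C W \<longleftrightarrow> W \<subseteq> Obj C \<and>
    (\<exists>Z \<in> W. is_zero_object C Z) \<and>
    (\<forall>A \<in> W. \<forall>B \<in> W. \<exists>P \<in> W. \<exists>i j p q. is_biproduct C A B P i j p q) \<and>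
    (\<forall>A \<in> W. \<forall>B \<in> Obj C. isomorphic C A B \<longrightarrow> B \<in> W)"

definition closed_under_kernels_of_epis :: "('o, 'm, 'b) preadd_cat_scheme \<Rightarrow> 'o set \<Rightarrow> bool"
  where "closed_under_kernels_of_epis C W \<longleftrightarrow>
    (\<forall>f k. is_epi C f \<and> Dom C f \<in> W \<and> Cod C f \<in> W \<and> is_kernel C f k \<longrightarrow> Dom C k \<in> W)"

definition closed_under_cokernels_of_monos :: "('o, 'm, 'b) preadd_cat_scheme \<Rightarrow> 'o set \<Rightarrow> bool"
  where "closed_under_cokernels_of_monos C W \<longleftrightarrow>
    (\<forall>f p. is_mono C f \<and> Dom C f \<in> W \<and> Cod C f \<in> W \<and> is_cokernel C f p \<longrightarrow> Cod C p \<in> W)"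

definition is_complex ::
  "('o, 'm, 'b) preadd_cat_scheme \<Rightarrow> (int \<Rightarrow> 'o) \<Rightarrow> (int \<Rightarrow> 'm) \<Rightarrow> bool"
  where "is_complex C X d \<longleftrightarrow> (\<forall>n. X n \<in> Obj C \<and> d n \<in> Hom C (X n) (X (n - 1)) \<and>
    d n \<cdot>\<^bsub>C\<^esub> d (n + 1) = Zero C (X (n + 1)) (X (n - 1)))"

definition exact_complex ::
  "('o, 'm, 'b) preadd_cat_scheme \<Rightarrow> (int \<Rightarrow> 'o) \<Rightarrow> (int \<Rightarrow> 'm) \<Rightarrow> bool"
  where "exact_complex C X d \<longleftrightarrow> is_complex C X d \<and> (\<forall>n. exact_at C (d (n + 1)) (d n))"

text \<open>In the lists of \<^const>\<open>exact_seq\<close> the last group of the sequence comes first.\<close>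

definition Hom_into_exact ::
  "('o, 'm, 'b) preadd_cat_scheme \<Rightarrow> 'o \<Rightarrow> (int \<Rightarrow> 'o) \<Rightarrow> (int \<Rightarrow> 'm) \<Rightarrow> bool"
  where "Hom_into_exact C W X d \<longleftrightarrow> (\<forall>n. exact_seq
    ([hom_group C W (X (n - 1)), hom_group C W (X n), hom_group C W (X (n + 1))],
     [\<lambda>f. d n \<cdot>\<^bsub>C\<^esub> f, \<lambda>f. d (n + 1) \<cdot>\<^bsub>C\<^esub> f]))"

definition Hom_from_exact ::
  "('o, 'm, 'b) preadd_cat_scheme \<Rightarrow> (int \<Rightarrow> 'o) \<Rightarrow> (int \<Rightarrow> 'm) \<Rightarrow> 'o \<Rightarrow> bool"
  where "Hom_from_exact C X d W \<longleftrightarrow> (\<forall>n. exact_seq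
    ([hom_group C (X (n + 1)) W, hom_group C (X n) W, hom_group C (X (n - 1)) W],
     [\<lambda>f. f \<cdot>\<^bsub>C\<^esub> d (n + 1), \<lambda>f. f \<cdot>\<^bsub>C\<^esub> d n]))"

definition totally_acyclic ::
  "('o, 'm, 'b) preadd_cat_scheme \<Rightarrow> 'o set \<Rightarrow> (int \<Rightarrow> 'o) \<Rightarrow> (int \<Rightarrow> 'm) \<Rightarrow> bool"
  where "totally_acyclic C W X d \<longleftrightarrow> exact_complex C X d \<and> (\<forall>n. X n \<in> W) \<and>
    (\<forall>V \<in> W. Hom_into_exact C V X d \<and> Hom_from_exact C X d V)"

definition Gorenstein :: "('o, 'm, 'b) preadd_cat_scheme \<Rightarrow> 'o set \<Rightarrow> 'o set"
  where "Gorenstein C W = {M \<in> Obj C. \<exists>X d p. totally_acyclic C W X d \<and>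
    is_cokernel C (d 1) p \<and> isomorphic C M (Cod C p)}"

end

theory Submission
  imports Defs
begin

text \<open>
  Call \<open>N\<close> orthogonal to \<open>W\<close> if \<open>Ext\<^sup>1(V, N) = 0 = Ext\<^sup>1(N, V)\<close> for all \<open>V\<close> in \<open>W\<close>. Cutting a totally
  acyclic complex into short exact sequences shows that the Gorenstein objects form the largest
  class of objects that are orthogonal to \<open>W\<close> and of which each member \<open>N\<close> sits in short exact
  sequences \<open>0 \<rightarrow> N' \<rightarrow> X \<rightarrow> N \<rightarrow> 0\<close> and \<open>0 \<rightarrow> N \<rightarrow> Y \<rightarrow> N'' \<rightarrow> 0\<close> with \<open>X, Y\<close> in \<open>W\<close> and with \<open>N', N''\<close> again
  in the class (\<open>Gorenstein_eq\<close>). Membership can therefore be proved by coinduction: one step to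
  the left and one step to the right suffice. The horseshoe lemma provides these steps for
  extensions, so the class is closed under extensions (\<open>gor_extension\<close>), and it contains \<open>W\<close>
  (\<open>W_gor\<close>).

  Now let \<open>0 \<rightarrow> K \<rightarrow> M \<rightarrow> N \<rightarrow> 0\<close> be exact with \<open>M, N\<close> Gorenstein, and take \<open>0 \<rightarrow> N' \<rightarrow> X \<rightarrow> N \<rightarrow> 0\<close> as above. The
  pullback \<open>P\<close> of \<open>M \<rightarrow> N \<leftarrow> X\<close> is an extension of \<open>M\<close> by \<open>N'\<close>, hence Gorenstein, and an extension of
  \<open>X\<close> by \<open>K\<close>. Take \<open>0 \<rightarrow> P' \<rightarrow> Y \<rightarrow> P \<rightarrow> 0\<close> and \<open>0 \<rightarrow> P \<rightarrow> Z \<rightarrow> P'' \<rightarrow> 0\<close> with \<open>Y, Z\<close> in \<open>W\<close> and \<open>P', P''\<close> Gorenstein.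
  If \<open>W\<close> is closed under kernels of epimorphisms, then the kernel \<open>L\<close> of \<open>Y \<rightarrow> P \<rightarrow> X\<close> is in \<open>W\<close>. This has two
  consequences. First, \<open>Y \<rightarrow> X\<close> splits, so \<open>P \<rightarrow> X\<close> splits too, and \<open>K\<close>, being a retract of \<open>P\<close>, is
  orthogonal to \<open>W\<close>. Second, \<open>0 \<rightarrow> P' \<rightarrow> L \<rightarrow> K \<rightarrow> 0\<close> is a step to the left for \<open>K\<close>. For the step to the
  right use \<open>K \<rightarrow> P \<rightarrow> Z\<close>: its cokernel is an extension of \<open>P''\<close> by \<open>X\<close> and thus Gorenstein. This is
  \<open>gor_kernel_of_epi\<close>. The statement on cokernels is the same
  one in the opposite category, since the description of the Gorenstein objects is self-dual.

  The orthogonality hypothesis on \<open>W\<close> enters as the splitting of every short exact sequence with end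
  terms in \<open>W\<close> (\<open>ext1_if_Ext_vanishes\<close>).
\<close>


section \<open>Morphism arithmetic\<close>

context category
begin

lemma Hom_Arr: "f \<in> Hom C A B \<Longrightarrow> f \<in> Arr C"
  and Hom_Dom: "f \<in> Hom C A B \<Longrightarrow> Dom C f = A"
  and Hom_Cod: "f \<in> Hom C A B \<Longrightarrow> Cod C f = B"
  by (auto simp: Hom_def)

lemma Hom_Obj:
  assumes "f \<in> Hom C A B"
  shows "A \<in> Obj C" and "B \<in> Obj C"
  using assms Dom_in_Obj Cod_in_Obj by (auto simp: Hom_def)

lemma Arr_Comp:
  assumes "f \<in> Arr C" "g \<in> Arr C" "Cod C f = Dom C g"
  shows "g \<cdot> f \<in> Arr C" and "Dom C (g \<cdot> f) = Dom C f" and "Cod C (g \<cdot> f) = Cod C g"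
  using Comp_in_Hom[of f "Dom C f" "Dom C g" g "Cod C g"] assms by (auto simp: Hom_def)

lemma Arr_assoc:
  assumes "f \<in> Arr C" "g \<in> Arr C" "h \<in> Arr C" "Cod C f = Dom C g" "Cod C g = Dom C h"
  shows "(h \<cdot> g) \<cdot> f = h \<cdot> (g \<cdot> f)"
  using Comp_assoc[of f "Dom C f" "Dom C g" g "Dom C h" h "Cod C h"] assms by (auto simp: Hom_def)

lemma Idm_simps:
  assumes "A \<in> Obj C"
  shows "Idm C A \<in> Arr C" and "Dom C (Idm C A) = A" and "Cod C (Idm C A) = A"
  using Idm_in_Hom[OF assms] by (auto simp: Hom_def)

lemma Arr_Idm_right: "\<lbrakk>f \<in> Arr C; Dom C f = A\<rbrakk> \<Longrightarrow> f \<cdot> Idm C A = f"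
  and Arr_Idm_left: "\<lbrakk>f \<in> Arr C; Cod C f = B\<rbrakk> \<Longrightarrow> Idm C B \<cdot> f = f"
  using Comp_Idm_right Comp_Idm_left by (auto simp: Hom_def)

lemmas arr_simps = Arr_Comp Arr_assoc Idm_simps Arr_Idm_right Arr_Idm_left
  Dom_in_Obj Cod_in_Obj

text \<open>Since \<open>Arr_assoc\<close> nests composites to the right, an equation \<open>p \<cdot> i = z\<close> is usable as a
  rewrite rule only together with this consequence of it.\<close>

lemma Comp_assoc_eq:
  assumes "p \<cdot> i = z" and "i \<in> Arr C" "p \<in> Arr C" "g \<in> Arr C" "Cod C i = Dom C p" "Cod C g = Dom C i"
  shows "p \<cdot> (i \<cdot> g) = z \<cdot> g"
  using Arr_assoc[of g i p] assms by simp

end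

definition neg :: "('o, 'm, 'b) preadd_cat_scheme \<Rightarrow> 'm \<Rightarrow> 'm"
  where "neg C f = inv\<^bsub>hom_group C (Dom C f) (Cod C f)\<^esub> f"

context preadditive_category
begin

lemma Hom_group_laws:
  assumes "A \<in> Obj C" "B \<in> Obj C"
  shows "Zero C A B \<in> Hom C A B"
    and "\<lbrakk>f \<in> Hom C A B; g \<in> Hom C A B\<rbrakk> \<Longrightarrow> f \<oplus>\<^sub>c g \<in> Hom C A B"
    and "\<lbrakk>f \<in> Hom C A B; g \<in> Hom C A B; h \<in> Hom C A B\<rbrakk>
      \<Longrightarrow> (f \<oplus>\<^sub>c g) \<oplus>\<^sub>c h = f \<oplus>\<^sub>c (g \<oplus>\<^sub>c h)"
    and "\<lbrakk>f \<in> Hom C A B; g \<in> Hom C A B\<rbrakk> \<Longrightarrow> f \<oplus>\<^sub>c g = g \<oplus>\<^sub>c f"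
    and "f \<in> Hom C A B \<Longrightarrow> Zero C A B \<oplus>\<^sub>c f = f"
    and "f \<in> Hom C A B \<Longrightarrow> f \<oplus>\<^sub>c Zero C A B = f"
    and "f \<in> Hom C A B \<Longrightarrow> neg C f \<in> Hom C A B"
    and "f \<in> Hom C A B \<Longrightarrow> f \<oplus>\<^sub>c neg C f = Zero C A B"
    and "f \<in> Hom C A B \<Longrightarrow> neg C f \<oplus>\<^sub>c f = Zero C A B"
proof -
  interpret G: comm_group "hom_group C A B" by (rule comm_group_Hom[OF assms])
  have n: "f \<in> Hom C A B \<Longrightarrow> neg C f = inv\<^bsub>hom_group C A B\<^esub> f" for f
    by (simp add: neg_def Hom_def)
  have [simp]: "carrier (hom_group C A B) = Hom C A B" "monoid.mult (hom_group C A B) = Add C"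
    "one (hom_group C A B) = Zero C A B"
    by (simp_all add: hom_group_def)
  show "Zero C A B \<in> Hom C A B"
    "\<lbrakk>f \<in> Hom C A B; g \<in> Hom C A B\<rbrakk> \<Longrightarrow> f \<oplus>\<^sub>c g \<in> Hom C A B"
    "\<lbrakk>f \<in> Hom C A B; g \<in> Hom C A B; h \<in> Hom C A B\<rbrakk>
      \<Longrightarrow> (f \<oplus>\<^sub>c g) \<oplus>\<^sub>c h = f \<oplus>\<^sub>c (g \<oplus>\<^sub>c h)"
    "\<lbrakk>f \<in> Hom C A B; g \<in> Hom C A B\<rbrakk> \<Longrightarrow> f \<oplus>\<^sub>c g = g \<oplus>\<^sub>c f"
    "f \<in> Hom C A B \<Longrightarrow> Zero C A B \<oplus>\<^sub>c f = f"
    "f \<in> Hom C A B \<Longrightarrow> f \<oplus>\<^sub>c Zero C A B = f"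
    "f \<in> Hom C A B \<Longrightarrow> neg C f \<in> Hom C A B"
    "f \<in> Hom C A B \<Longrightarrow> f \<oplus>\<^sub>c neg C f = Zero C A B"
    "f \<in> Hom C A B \<Longrightarrow> neg C f \<oplus>\<^sub>c f = Zero C A B"
    using G.one_closed G.m_closed[of f g] G.m_assoc[of f g h] G.m_comm[of f g] G.l_one[of f]
      G.r_one[of f] G.inv_closed[of f] G.r_inv[of f] G.l_inv[of f] n by simp_all
qed

lemmas Zero_in_Hom = Hom_group_laws(1)

lemma Add_in_Hom: "\<lbrakk>f \<in> Hom C A B; g \<in> Hom C A B\<rbrakk> \<Longrightarrow> f \<oplus>\<^sub>c g \<in> Hom C A B"
  using Hom_group_laws(2) Hom_Obj by metis

lemma neg_in_Hom: "f \<in> Hom C A B \<Longrightarrow> neg C f \<in> Hom C A B"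
  using Hom_group_laws(7) Hom_Obj by metis

lemma add_simps:
  assumes "f \<in> Arr C" "g \<in> Arr C" "Dom C g = Dom C f" "Cod C g = Cod C f"
  shows "f \<oplus>\<^sub>c g \<in> Arr C" "Dom C (f \<oplus>\<^sub>c g) = Dom C f" "Cod C (f \<oplus>\<^sub>c g) = Cod C f"
  using Add_in_Hom[of f "Dom C f" "Cod C f" g] assms by (auto simp: Hom_def)

lemma neg_simps:
  assumes "f \<in> Arr C"
  shows "neg C f \<in> Arr C" "Dom C (neg C f) = Dom C f" "Cod C (neg C f) = Cod C f"
  using neg_in_Hom[of f "Dom C f" "Cod C f"] assms by (auto simp: Hom_def)

lemma Zero_simps:
  assumes "A \<in> Obj C" "B \<in> Obj C"
  shows "Zero C A B \<in> Arr C" "Dom C (Zero C A B) = A" "Cod C (Zero C A B) = B"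
  using Zero_in_Hom[OF assms] by (auto simp: Hom_def)

lemma Add_Zero:
  "\<lbrakk>f \<in> Arr C; Dom C f = A; Cod C f = B\<rbrakk> \<Longrightarrow> f \<oplus>\<^sub>c Zero C A B = f"
  "\<lbrakk>f \<in> Arr C; Dom C f = A; Cod C f = B\<rbrakk> \<Longrightarrow> Zero C A B \<oplus>\<^sub>c f = f"
  using Hom_group_laws(5,6)[of A B f] Dom_in_Obj[of f] Cod_in_Obj[of f] by (auto simp: Hom_def)

lemma Add_neg:
  "f \<in> Arr C \<Longrightarrow> f \<oplus>\<^sub>c neg C f = Zero C (Dom C f) (Cod C f)"
  "f \<in> Arr C \<Longrightarrow> neg C f \<oplus>\<^sub>c f = Zero C (Dom C f) (Cod C f)"
  using Hom_group_laws(8,9)[of "Dom C f" "Cod C f" f] Dom_in_Obj[of f] Cod_in_Obj[of f]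
  by (auto simp: Hom_def)

lemma Add_right_unique:
  assumes "f \<in> Hom C A B" "g \<in> Hom C A B" "g' \<in> Hom C A B" "f \<oplus>\<^sub>c g = f \<oplus>\<^sub>c g'"
  shows "g = g'"
proof -
  have ob: "A \<in> Obj C" "B \<in> Obj C" using Hom_Obj[OF assms(1)] by auto
  note L = Hom_group_laws[OF ob]
  have "g = (neg C f \<oplus>\<^sub>c f) \<oplus>\<^sub>c g" using L(5,9) assms by simp
  also have "\<dots> = neg C f \<oplus>\<^sub>c (f \<oplus>\<^sub>c g')" using L(3)[OF L(7)] assms by simp
  also have "\<dots> = g'" using L(3)[OF L(7), of f f g'] L(5,9) assms by simp
  finally show ?thesis .
qed

lemma Comp_Zero:
  "\<lbrakk>A \<in> Obj C; g \<in> Arr C; Dom C g = B\<rbrakk> \<Longrightarrow> g \<cdot> Zero C A B = Zero C A (Cod C g)"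
  "\<lbrakk>D \<in> Obj C; f \<in> Arr C; Cod C f = B\<rbrakk> \<Longrightarrow> Zero C B D \<cdot> f = Zero C (Dom C f) D"
proof -
  assume a: "A \<in> Obj C" "g \<in> Arr C" "Dom C g = B"
  let ?z = "Zero C A B" and ?w = "g \<cdot> Zero C A B"
  have B: "B \<in> Obj C" "Cod C g \<in> Obj C" using a Dom_in_Obj Cod_in_Obj by auto
  have z: "?z \<in> Hom C A B" using Zero_in_Hom a B by simp
  have g: "g \<in> Hom C B (Cod C g)" using a by (simp add: Hom_def)
  have w: "?w \<in> Hom C A (Cod C g)" using Comp_in_Hom[OF z g] .
  have "?w \<oplus>\<^sub>c ?w = g \<cdot> (?z \<oplus>\<^sub>c ?z)" using Comp_Add_right[OF z z g] by simp
  also have "?z \<oplus>\<^sub>c ?z = ?z" using Hom_group_laws(5)[OF a(1) B(1) z] .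
  also have "?w = ?w \<oplus>\<^sub>c Zero C A (Cod C g)" using Hom_group_laws(6)[OF a(1) B(2) w] by simp
  finally show "?w = Zero C A (Cod C g)"
    using Add_right_unique[OF w w Zero_in_Hom[OF a(1) B(2)]] by simp
next
  assume a: "D \<in> Obj C" "f \<in> Arr C" "Cod C f = B"
  let ?z = "Zero C B D" and ?w = "Zero C B D \<cdot> f"
  have B: "B \<in> Obj C" "Dom C f \<in> Obj C" using a Dom_in_Obj Cod_in_Obj by auto
  have z: "?z \<in> Hom C B D" using Zero_in_Hom a B by simp
  have f: "f \<in> Hom C (Dom C f) B" using a by (simp add: Hom_def)
  have w: "?w \<in> Hom C (Dom C f) D" using Comp_in_Hom[OF f z] .
  have "?w \<oplus>\<^sub>c ?w = (?z \<oplus>\<^sub>c ?z) \<cdot> f" using Comp_Add_left[OF f z z] by simp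
  also have "?z \<oplus>\<^sub>c ?z = ?z" using Hom_group_laws(5)[OF B(1) a(1) z] .
  also have "?w = ?w \<oplus>\<^sub>c Zero C (Dom C f) D" using Hom_group_laws(6)[OF B(2) a(1) w] by simp
  finally show "?w = Zero C (Dom C f) D"
    using Add_right_unique[OF w w Zero_in_Hom[OF B(2) a(1)]] by simp
qed

lemma Arr_Add_right:
  "\<lbrakk>f \<in> Arr C; f' \<in> Arr C; g \<in> Arr C; Dom C f' = Dom C f; Cod C f' = Cod C f; Dom C g = Cod C f\<rbrakk>
    \<Longrightarrow> g \<cdot> (f \<oplus>\<^sub>c f') = g \<cdot> f \<oplus>\<^sub>c g \<cdot> f'"
  using Comp_Add_right[of f "Dom C f" "Cod C f" f' g "Cod C g"] by (simp add: Hom_def)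

lemma Arr_Add_left:
  "\<lbrakk>f \<in> Arr C; g \<in> Arr C; g' \<in> Arr C; Dom C g' = Dom C g; Cod C g' = Cod C g; Dom C g = Cod C f\<rbrakk>
    \<Longrightarrow> (g \<oplus>\<^sub>c g') \<cdot> f = g \<cdot> f \<oplus>\<^sub>c g' \<cdot> f"
  using Comp_Add_left[of f "Dom C f" "Cod C f" g "Cod C g" g'] by (simp add: Hom_def)

lemma Comp_neg:
  assumes "f \<in> Arr C" "g \<in> Arr C" "Dom C g = Cod C f"
  shows "g \<cdot> neg C f = neg C (g \<cdot> f)" and "neg C g \<cdot> f = neg C (g \<cdot> f)"
proof -
  let ?A = "Dom C f" and ?B = "Cod C g"
  note s = arr_simps neg_simps Zero_simps Comp_Zero
  have "g \<cdot> f \<oplus>\<^sub>c g \<cdot> neg C f = g \<cdot> f \<oplus>\<^sub>c neg C (g \<cdot> f)"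
    using assms by (simp add: s Arr_Add_right[symmetric] Add_neg)
  then show "g \<cdot> neg C f = neg C (g \<cdot> f)"
    using Add_right_unique[of "g \<cdot> f" ?A ?B "g \<cdot> neg C f" "neg C (g \<cdot> f)"] assms
    by (simp add: Hom_def s)
  have "g \<cdot> f \<oplus>\<^sub>c neg C g \<cdot> f = g \<cdot> f \<oplus>\<^sub>c neg C (g \<cdot> f)"
    using assms by (simp add: s Arr_Add_left[symmetric] Add_neg)
  then show "neg C g \<cdot> f = neg C (g \<cdot> f)"
    using Add_right_unique[of "g \<cdot> f" ?A ?B "neg C g \<cdot> f" "neg C (g \<cdot> f)"] assms
    by (simp add: Hom_def s)
qed

lemma eq_if_Add_neg_Zero:
  assumes "f \<in> Hom C A B" "g \<in> Hom C A B" "f \<oplus>\<^sub>c neg C g = Zero C A B"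
  shows "f = g"
proof -
  have "neg C g \<oplus>\<^sub>c f = neg C g \<oplus>\<^sub>c g"
    using assms Hom_group_laws(4,9)[of A B] Hom_Obj[OF assms(1)] neg_in_Hom by metis
  then show ?thesis using Add_right_unique[OF neg_in_Hom[OF assms(2)] assms(1,2)] by simp
qed

lemma neg_Zero: "\<lbrakk>A \<in> Obj C; B \<in> Obj C\<rbrakk> \<Longrightarrow> neg C (Zero C A B) = Zero C A B"
  using Hom_group_laws(5,8)[OF _ _ Zero_in_Hom] Hom_group_laws(5,7) Zero_in_Hom by metis

lemmas cat_simps = neg_Zero Hom_def arr_simps add_simps neg_simps Zero_simps Add_Zero Add_neg Comp_Zero
  Arr_Add_right Arr_Add_left Comp_neg

lemma is_monoI:
  assumes f: "f \<in> Hom C A B"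
    and 0: "\<And>T u. \<lbrakk>u \<in> Hom C T A; f \<cdot> u = Zero C T B\<rbrakk> \<Longrightarrow> u = Zero C T A"
  shows "is_mono C f"
  unfolding is_mono_def
proof (intro conjI ballI impI)
  show "f \<in> Arr C" using f by (rule Hom_Arr)
  fix T g h assume *: "T \<in> Obj C" "g \<in> Hom C T (Dom C f)" "h \<in> Hom C T (Dom C f)" "f \<cdot> g = f \<cdot> h"
  have gh: "g \<in> Hom C T A" "h \<in> Hom C T A" using * f by (auto simp: Hom_def)
  have "f \<cdot> (g \<oplus>\<^sub>c neg C h) = Zero C T B" using * f by (simp add: cat_simps)
  then have "g \<oplus>\<^sub>c neg C h = Zero C T A" by (rule 0[OF Add_in_Hom[OF gh(1) neg_in_Hom[OF gh(2)]]])
  then show "g = h" by (rule eq_if_Add_neg_Zero[OF gh])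
qed

lemma is_mono_Zero:
  assumes "is_mono C f" "f \<in> Hom C A B" "u \<in> Hom C T A" "f \<cdot> u = Zero C T B"
  shows "u = Zero C T A"
proof -
  have ob: "A \<in> Obj C" "T \<in> Obj C" using assms Hom_Obj by auto
  have "f \<cdot> u = f \<cdot> Zero C T A" using assms ob by (simp add: cat_simps)
  then show ?thesis using assms Zero_in_Hom[OF ob(2,1)] ob unfolding is_mono_def
    by (simp add: Hom_def)
qed

lemma is_mono_cancel:
  assumes "is_mono C f" "f \<in> Hom C A B" "u \<in> Hom C T A" "v \<in> Hom C T A" "f \<cdot> u = f \<cdot> v"
  shows "u = v"
  using assms Hom_Obj[OF assms(3)] unfolding is_mono_def by (simp add: Hom_def)

end

section \<open>The opposite category\<close>

definition op :: "('o, 'm, 'b) preadd_cat_scheme \<Rightarrow> ('o, 'm) preadd_cat"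
  where "op C = \<lparr>Obj = Obj C, Arr = Arr C, Dom = Cod C, Cod = Dom C, Idm = Idm C,
    Comp = (\<lambda>g f. f \<cdot>\<^bsub>C\<^esub> g), Zero = (\<lambda>A B. Zero C B A), Add = Add C\<rparr>"

lemma op_sel [simp]:
  "Obj (op C) = Obj C" "Arr (op C) = Arr C" "Dom (op C) = Cod C" "Cod (op C) = Dom C"
  "Idm (op C) = Idm C" "g \<cdot>\<^bsub>op C\<^esub> f = f \<cdot>\<^bsub>C\<^esub> g" "Zero (op C) A B = Zero C B A" "Add (op C) = Add C"
  by (simp_all add: op_def)

lemma op_Hom [simp]: "Hom (op C) A B = Hom C B A"
  by (auto simp: Hom_def)

lemma op_hom_group [simp]: "hom_group (op C) A B = hom_group C B A"
  by (simp add: hom_group_def)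

text \<open>With these rules, the dual of a lemma on \<open>C\<close> is obtained by instantiating it at \<open>op C\<close> and
  simplifying; all dual versions below arise in this way.\<close>

lemma op_preds [simp]:
  "is_mono (op C) f = is_epi C f" "is_epi (op C) f = is_mono C f"
  "is_kernel (op C) f k = is_cokernel C f k" "is_cokernel (op C) f k = is_kernel C f k"
  "is_zero_object (op C) Z = is_zero_object C Z"
  "is_biproduct (op C) A B P i j p q = is_biproduct C A B P p q i j"
  "isomorphic (op C) A B = isomorphic C A B"
        apply (auto simp: is_mono_def is_epi_def is_kernel_def is_cokernel_def is_zero_object_def
      is_biproduct_def isomorphic_def)
  done

lemma (in abelian_category) op_biproduct_exists:
  "\<lbrakk>A \<in> Obj C; B \<in> Obj C\<rbrakk> \<Longrightarrow> \<exists>P i j p q. is_biproduct C A B P p q i j"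
  using biproduct_exists by metis

lemma (in abelian_category) op: "abelian_category (op C)"
  by (intro abelian_category.intro abelian_category_axioms.intro preadditive_category.intro
      preadditive_category_axioms.intro category.intro)
    (simp_all add: Dom_in_Obj Cod_in_Obj Idm_in_Hom Comp_in_Hom Comp_Idm_right Comp_Idm_left
      Comp_assoc Comp_Add_left Comp_Add_right comm_group_Hom kernel_exists cokernel_exists
      zero_object_exists mono_normal epi_conormal op_biproduct_exists)

context abelian_category
begin

lemma op_preadditive: "preadditive_category (op C)"
  using op by (rule abelian_category.axioms(1))

lemmas is_epiI = preadditive_category.is_monoI[OF op_preadditive, simplified]
lemmas is_epi_Zero = preadditive_category.is_mono_Zero[OF op_preadditive, simplified]
lemmas is_epi_cancel = preadditive_category.is_mono_cancel[OF op_preadditive, simplified]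
end

section \<open>Short exact sequences\<close>

definition ses :: "('o, 'm, 'b) preadd_cat_scheme \<Rightarrow> 'o \<Rightarrow> 'm \<Rightarrow> 'o \<Rightarrow> 'm \<Rightarrow> 'o \<Rightarrow> bool"
  where "ses C A i B p D \<longleftrightarrow>
    i \<in> Hom C A B \<and> p \<in> Hom C B D \<and> is_kernel C p i \<and> is_cokernel C i p"

lemma op_ses [simp]: "ses (op C) A i B p D = ses C D p B i A"
  by (auto simp: ses_def)

context preadditive_category
begin

lemma is_kernel_mono:
  assumes "is_kernel C f k"
  shows "is_mono C k"
proof (rule is_monoI)
  show k: "k \<in> Hom C (Dom C k) (Cod C k)" using assms by (simp add: is_kernel_def Hom_def)
  fix T u assume u: "u \<in> Hom C T (Dom C k)" "k \<cdot> u = Zero C T (Cod C k)"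
  have T: "T \<in> Obj C" "Dom C k \<in> Obj C" "Cod C k \<in> Obj C" using Hom_Obj u(1) k by auto
  have f: "f \<in> Arr C" "Dom C f = Cod C k" using assms by (auto simp: is_kernel_def)
  have z: "Zero C T (Cod C k) \<in> Hom C T (Dom C f)" "f \<cdot> Zero C T (Cod C k) = Zero C T (Cod C f)"
    "Zero C T (Dom C k) \<in> Hom C T (Dom C k)" "k \<cdot> Zero C T (Dom C k) = Zero C T (Cod C k)"
    using T f k by (auto simp: cat_simps)
  then have "\<exists>!h. h \<in> Hom C T (Dom C k) \<and> k \<cdot> h = Zero C T (Cod C k)"
    using assms T by (auto simp: is_kernel_def)
  then show "u = Zero C T (Dom C k)" using u z by blast
qed

lemma is_kernel_lift:
  assumes "is_kernel C f k" "f \<in> Hom C A B" "g \<in> Hom C T A" "f \<cdot> g = Zero C T B"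
  obtains h where "h \<in> Hom C T (Dom C k)" "k \<cdot> h = g"
proof -
  have "Dom C f = A" "Cod C f = B" "T \<in> Obj C"
    using assms(2) Hom_Obj[OF assms(3)] by (auto simp: Hom_def)
  then have "\<exists>!h. h \<in> Hom C T (Dom C k) \<and> k \<cdot> h = g"
    using assms(1,3,4) unfolding is_kernel_def by blast
  then show ?thesis using that by blast
qed

lemma is_kernelI:
  assumes "k \<in> Hom C K A" "f \<in> Hom C A B" "f \<cdot> k = Zero C K B" "is_mono C k"
    and "\<And>T g. \<lbrakk>g \<in> Hom C T A; f \<cdot> g = Zero C T B\<rbrakk> \<Longrightarrow> \<exists>h \<in> Hom C T K. k \<cdot> h = g"
  shows "is_kernel C f k"
  unfolding is_kernel_def
proof (intro conjI ballI impI)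
  show "f \<in> Arr C" "k \<in> Arr C" "Cod C k = Dom C f" "f \<cdot> k = Zero C (Dom C k) (Cod C f)"
    using assms by (auto simp: Hom_def)
  fix T g assume "T \<in> Obj C" "g \<in> Hom C T (Dom C f)" "f \<cdot> g = Zero C T (Cod C f)"
  then obtain h where "h \<in> Hom C T K" "k \<cdot> h = g" using assms(2,5) by (auto simp: Hom_def)
  moreover have "h' = h" if "h' \<in> Hom C T K" "k \<cdot> h' = g" for h'
    using is_mono_cancel[OF assms(4,1) that(1) calculation(1)] that(2) calculation(2) by simp
  ultimately show "\<exists>!h. h \<in> Hom C T (Dom C k) \<and> k \<cdot> h = g"
    using assms(1) by (auto simp: Hom_def)
qed

lemma sesD:
  assumes "ses C A i B p D"
  shows "i \<in> Hom C A B" "p \<in> Hom C B D" "p \<cdot> i = Zero C A D"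
    "A \<in> Obj C" "B \<in> Obj C" "D \<in> Obj C"
proof -
  show i: "i \<in> Hom C A B" and p: "p \<in> Hom C B D" using assms by (simp_all add: ses_def)
  show "p \<cdot> i = Zero C A D" using assms i p by (simp add: ses_def is_kernel_def Hom_def)
  show "A \<in> Obj C" "B \<in> Obj C" "D \<in> Obj C" using Hom_Obj i p by auto
qed

lemma ses_mono: "ses C A i B p D \<Longrightarrow> is_mono C i"
  using is_kernel_mono by (auto simp: ses_def)

lemma ses_lift:
  assumes "ses C A i B p D" "g \<in> Hom C T B" "p \<cdot> g = Zero C T D"
  obtains h where "h \<in> Hom C T A" "i \<cdot> h = g"
proof -
  have *: "is_kernel C p i" "p \<in> Hom C B D" "Dom C i = A" using assms(1) by (auto simp: ses_def Hom_def)
  from is_kernel_lift[OF *(1,2) assms(2,3)] show ?thesis using that *(3) by metis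
qed

end

context abelian_category
begin

lemmas is_cokernel_epi = preadditive_category.is_kernel_mono[OF op_preadditive, simplified]
lemmas is_cokernel_colift = preadditive_category.is_kernel_lift[OF op_preadditive, simplified]
lemmas is_cokernelI = preadditive_category.is_kernelI[OF op_preadditive, simplified]
lemmas ses_epi = preadditive_category.ses_mono[OF op_preadditive, simplified]
lemmas ses_colift = preadditive_category.ses_lift[OF op_preadditive, simplified]

text \<open>A conormal epi is the cokernel of some \<open>g\<close>, and \<open>g\<close> factors through the kernel \<open>i\<close>, so
  whatever kills \<open>i\<close> kills \<open>g\<close>.\<close>

lemma epi_cokernel_of_kernel:
  assumes "is_epi C p" "is_kernel C p i"
  shows "is_cokernel C i p"
proof -
  obtain g where g: "is_cokernel C g p" using epi_conormal assms(1) by blast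
  have p: "p \<in> Hom C (Dom C p) (Cod C p)" and i: "i \<in> Hom C (Dom C i) (Dom C p)"
    and gH: "g \<in> Hom C (Dom C g) (Dom C p)"
    and pi: "p \<cdot> i = Zero C (Dom C i) (Cod C p)" and pg: "p \<cdot> g = Zero C (Dom C g) (Cod C p)"
    using assms g by (auto simp: is_kernel_def is_cokernel_def Hom_def)
  obtain h where h: "h \<in> Hom C (Dom C g) (Dom C i)" "i \<cdot> h = g"
    using is_kernel_lift[OF assms(2) p gH pg] by blast
  show ?thesis
  proof (rule is_cokernelI[OF p i pi assms(1)])
    fix T u assume u: "u \<in> Hom C (Dom C p) T" "u \<cdot> i = Zero C (Dom C i) T"
    have "u \<cdot> g = (u \<cdot> i) \<cdot> h" using h(2) Comp_assoc[OF h(1) i u(1)] by simp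
    also have "\<dots> = Zero C (Dom C g) T"
      using u Hom_Obj[OF u(1)] h(1) i by (simp add: cat_simps)
    finally show "\<exists>h\<in>Hom C (Cod C p) T. h \<cdot> p = u"
      using is_cokernel_colift[OF g gH u(1)] by blast
  qed
qed

lemma ses_epi_kernel:
  assumes "is_epi C p" "is_kernel C p i"
  shows "ses C (Dom C i) i (Dom C p) p (Cod C p)"
  using epi_cokernel_of_kernel[OF assms] assms by (simp add: ses_def is_kernel_def Hom_def)

lemma epi_ses:
  assumes "is_epi C p" "p \<in> Hom C B D"
  obtains A i where "ses C A i B p D"
proof -
  obtain i where i: "is_kernel C p i" using kernel_exists assms(2) by (auto simp: Hom_def)
  then show ?thesis using ses_epi_kernel[OF assms(1) i] that assms(2) by (auto simp: Hom_def)
qed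

lemma sesI:
  assumes "i \<in> Hom C A B" "p \<in> Hom C B D" "p \<cdot> i = Zero C A D" "is_mono C i" "is_epi C p"
    and "\<And>T g. \<lbrakk>g \<in> Hom C T B; p \<cdot> g = Zero C T D\<rbrakk> \<Longrightarrow> \<exists>h \<in> Hom C T A. i \<cdot> h = g"
  shows "ses C A i B p D"
proof -
  have "is_kernel C p i" by (rule is_kernelI[OF assms(1-4,6)])
  with ses_epi_kernel[OF assms(5) this] show ?thesis using assms(1,2) by (simp add: Hom_def)
qed

lemmas ses_mono_cokernel = abelian_category.ses_epi_kernel[OF op, simplified]
lemmas mono_ses = abelian_category.epi_ses[OF op, simplified]
lemmas mono_kernel_of_cokernel = abelian_category.epi_cokernel_of_kernel[OF op, simplified]

section \<open>Biproducts and pullbacks\<close>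

lemma is_biproductD:
  assumes "is_biproduct C A B P i j p q"
  shows "i \<in> Hom C A P" "j \<in> Hom C B P" "p \<in> Hom C P A" "q \<in> Hom C P B"
    "p \<cdot> i = Idm C A" "q \<cdot> j = Idm C B" "q \<cdot> i = Zero C A B" "p \<cdot> j = Zero C B A"
    "i \<cdot> p \<oplus>\<^sub>c j \<cdot> q = Idm C P" "A \<in> Obj C" "B \<in> Obj C" "P \<in> Obj C"
  using assms Hom_Obj by (auto simp: is_biproduct_def)

lemma biproduct_arrow_eq:
  assumes "is_biproduct C A B P i j p q" "u \<in> Hom C T P"
  shows "u = i \<cdot> (p \<cdot> u) \<oplus>\<^sub>c j \<cdot> (q \<cdot> u)"
proof -
  note b = is_biproductD[OF assms(1)]
  have "u = (i \<cdot> p \<oplus>\<^sub>c j \<cdot> q) \<cdot> u" using b(9) assms(2) by (simp add: cat_simps)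
  then show ?thesis using b(1-4) assms(2) by (simp add: cat_simps)
qed

lemma biproduct_arrow_Zero:
  assumes "is_biproduct C A B P i j p q" "u \<in> Hom C T P"
    "p \<cdot> u = Zero C T A" "q \<cdot> u = Zero C T B"
  shows "u = Zero C T P"
  using biproduct_arrow_eq[OF assms(1,2)] assms(2-4) is_biproductD[OF assms(1)] Hom_Obj[OF assms(2)]
  by (simp add: cat_simps)

lemma neg_eq_Zero:
  assumes "f \<in> Hom C A B" "neg C f = Zero C A B"
  shows "f = Zero C A B"
  using Hom_group_laws(6,8)[OF Hom_Obj[OF assms(1)] assms(1)] assms(2) by simp

text \<open>Uniqueness in the universal property is put additively: only the zero arrow is killed by both
  projections.\<close>

definition is_pullback :: "'m \<Rightarrow> 'm \<Rightarrow> 'o \<Rightarrow> 'm \<Rightarrow> 'm \<Rightarrow> bool"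
  where "is_pullback f g P a b \<longleftrightarrow>
    a \<in> Hom C P (Dom C f) \<and> b \<in> Hom C P (Dom C g) \<and> f \<cdot> a = g \<cdot> b \<and>
    (\<forall>T u v. u \<in> Hom C T (Dom C f) \<longrightarrow> v \<in> Hom C T (Dom C g) \<longrightarrow> f \<cdot> u = g \<cdot> v \<longrightarrow>
      (\<exists>w \<in> Hom C T P. a \<cdot> w = u \<and> b \<cdot> w = v)) \<and>
    (\<forall>T. \<forall>w \<in> Hom C T P. a \<cdot> w = Zero C T (Dom C f) \<longrightarrow> b \<cdot> w = Zero C T (Dom C g) \<longrightarrow>
      w = Zero C T P)"

lemma pullback_commute: "is_pullback f g P a b \<Longrightarrow> is_pullback g f P b a"
  unfolding is_pullback_def by metis

text \<open>The pullback is the kernel of \<open>(f, -g)\<close> on the biproduct. When one of \<open>f\<close>, \<open>g\<close> is epi,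
  so is \<open>(f, -g)\<close>; it is then the cokernel of the pullback inclusion, which forces the opposite
  projection to be epi.\<close>

lemma pullback_exists:
  assumes f: "f \<in> Hom C M N" and g: "g \<in> Hom C X N"
  obtains P a b where "is_pullback f g P a b" "is_epi C f \<Longrightarrow> is_epi C b" "is_epi C g \<Longrightarrow> is_epi C a"
proof -
  have ob: "M \<in> Obj C" "N \<in> Obj C" "X \<in> Obj C" using f g Hom_Obj by auto
  obtain Q i j p q where bi: "is_biproduct C M X Q i j p q" using biproduct_exists ob by blast
  note b = is_biproductD[OF bi]
  note r = Comp_assoc_eq[OF b(5)] Comp_assoc_eq[OF b(6)] Comp_assoc_eq[OF b(7)] Comp_assoc_eq[OF b(8)]
  define m where "m = f \<cdot> p \<oplus>\<^sub>c neg C (g \<cdot> q)"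
  have m: "m \<in> Hom C Q N" unfolding m_def using b f g by (simp add: cat_simps)
  have mi: "m \<cdot> i = f" and mj: "m \<cdot> j = neg C g"
    unfolding m_def using b f g by (auto simp add: cat_simps)
  obtain k where k: "is_kernel C m k" using kernel_exists m by (auto simp: Hom_def)
  define P where "P = Dom C k"
  have kH: "k \<in> Hom C P Q" and mk: "m \<cdot> k = Zero C P N"
    using k m by (auto simp: is_kernel_def P_def Hom_def)
  have P: "P \<in> Obj C" using kH Hom_Obj by blast
  have H: "p \<cdot> k \<in> Hom C P M" "q \<cdot> k \<in> Hom C P X" using kH b by (auto simp: cat_simps)
  have "f \<cdot> (p \<cdot> k) \<oplus>\<^sub>c neg C (g \<cdot> (q \<cdot> k)) = m \<cdot> k"
    unfolding m_def using b f g kH by (simp add: cat_simps)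
  then have eq: "f \<cdot> (p \<cdot> k) = g \<cdot> (q \<cdot> k)"
    using eq_if_Add_neg_Zero[OF Comp_in_Hom[OF H(1) f] Comp_in_Hom[OF H(2) g]] mk by simp
  have lift: "\<exists>w \<in> Hom C T P. (p \<cdot> k) \<cdot> w = u \<and> (q \<cdot> k) \<cdot> w = v"
    if uv: "u \<in> Hom C T M" "v \<in> Hom C T X" "f \<cdot> u = g \<cdot> v" for T u v
  proof -
    have T: "T \<in> Obj C" using uv Hom_Obj by blast
    let ?w = "i \<cdot> u \<oplus>\<^sub>c j \<cdot> v"
    have w: "?w \<in> Hom C T Q" using uv b by (simp add: cat_simps)
    have e: "p \<cdot> ?w = u" "q \<cdot> ?w = v" using uv b T by (simp_all add: cat_simps r)
    have "m \<cdot> ?w = (m \<cdot> i) \<cdot> u \<oplus>\<^sub>c (m \<cdot> j) \<cdot> v"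
      using m uv b by (simp add: cat_simps)
    also have "\<dots> = Zero C T N" unfolding mi mj using uv f g by (simp add: cat_simps)
    finally obtain h where h: "h \<in> Hom C T P" "k \<cdot> h = ?w"
      using is_kernel_lift[OF k m w] P_def by metis
    have "(p \<cdot> k) \<cdot> h = p \<cdot> ?w" "(q \<cdot> k) \<cdot> h = q \<cdot> ?w"
      using Comp_assoc[OF h(1) kH] b(3,4) h(2) by simp_all
    then show ?thesis using h(1) e by auto
  qed
  have joint: "w = Zero C T P"
    if w: "w \<in> Hom C T P" "(p \<cdot> k) \<cdot> w = Zero C T M" "(q \<cdot> k) \<cdot> w = Zero C T X" for T w
  proof -
    have "k \<cdot> w = Zero C T Q"
      using biproduct_arrow_Zero[OF bi Comp_in_Hom[OF w(1) kH]] w Comp_assoc[OF w(1) kH] b(3,4)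
      by simp
    then show ?thesis using is_mono_Zero[OF is_kernel_mono[OF k] kH w(1)] by simp
  qed
  have pb: "is_pullback f g P (p \<cdot> k) (q \<cdot> k)"
    unfolding is_pullback_def Hom_Dom[OF f] Hom_Dom[OF g] using H eq lift joint by blast
  have "is_epi C f \<or> is_epi C g \<Longrightarrow> is_epi C m"
  proof (rule is_epiI[OF m])
    fix T u assume fg: "is_epi C f \<or> is_epi C g" and u: "u \<in> Hom C N T" "u \<cdot> m = Zero C Q T"
    have T: "T \<in> Obj C" using u Hom_Obj by blast
    have "u \<cdot> (m \<cdot> i) = Zero C M T" "u \<cdot> (m \<cdot> j) = Zero C X T"
      using Comp_assoc[OF b(1) m u(1)] Comp_assoc[OF b(2) m u(1)] u(2) b(1,2) T
      by (simp_all add: cat_simps)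
    then have "u \<cdot> f = Zero C M T" "neg C (u \<cdot> g) = Zero C X T"
      unfolding mi mj using u g by (simp_all add: cat_simps)
    then have "u \<cdot> f = Zero C M T" "u \<cdot> g = Zero C X T"
      using neg_eq_Zero[OF Comp_in_Hom[OF g u(1)]] by simp_all
    then show "u = Zero C N T" using fg is_epi_Zero[OF _ f u(1)] is_epi_Zero[OF _ g u(1)] by blast
  qed
  then have cok: "is_cokernel C k m" if "is_epi C f \<or> is_epi C g"
    using epi_cokernel_of_kernel[OF _ k] that by simp
  have "is_epi C (q \<cdot> k)" if ef: "is_epi C f"
  proof (rule is_epiI[OF H(2)])
    fix T u assume u: "u \<in> Hom C X T" "u \<cdot> (q \<cdot> k) = Zero C P T"
    have T: "T \<in> Obj C" using u Hom_Obj by blast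
    have "(u \<cdot> q) \<cdot> k = Zero C P T" using u b kH by (simp add: cat_simps)
    then obtain v where v: "v \<in> Hom C N T" "v \<cdot> m = u \<cdot> q"
      using is_cokernel_colift[OF cok kH Comp_in_Hom[OF b(4) u(1)]] ef Hom_Cod[OF m] by metis
    have "v \<cdot> f = (u \<cdot> q) \<cdot> i" using v(2) mi Comp_assoc[OF b(1) m v(1)] by simp
    also have "\<dots> = Zero C M T" using u b T by (simp add: cat_simps)
    finally have "v = Zero C N T" using is_epi_Zero[OF ef f v(1)] by simp
    then have "u \<cdot> q = Zero C Q T" using v(2) m T by (simp add: cat_simps)
    then have "(u \<cdot> q) \<cdot> j = Zero C X T" using b T by (simp add: cat_simps)
    then show "u = Zero C X T" using u b by (simp add: cat_simps)
  qed
  moreover have "is_epi C (p \<cdot> k)" if eg: "is_epi C g"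
  proof (rule is_epiI[OF H(1)])
    fix T u assume u: "u \<in> Hom C M T" "u \<cdot> (p \<cdot> k) = Zero C P T"
    have T: "T \<in> Obj C" using u Hom_Obj by blast
    have "(u \<cdot> p) \<cdot> k = Zero C P T" using u b kH by (simp add: cat_simps)
    then obtain v where v: "v \<in> Hom C N T" "v \<cdot> m = u \<cdot> p"
      using is_cokernel_colift[OF cok kH Comp_in_Hom[OF b(3) u(1)]] eg Hom_Cod[OF m] by metis
    have "v \<cdot> neg C g = (u \<cdot> p) \<cdot> j" using v(2) mj Comp_assoc[OF b(2) m v(1)] by simp
    also have "\<dots> = Zero C X T" using u b T by (simp add: cat_simps)
    finally have "v \<cdot> g = Zero C X T" using neg_eq_Zero[OF Comp_in_Hom[OF g v(1)]] v g
      by (simp add: cat_simps)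
    then have "v = Zero C N T" using is_epi_Zero[OF eg g v(1)] by simp
    then have "u \<cdot> p = Zero C Q T" using v(2) m T by (simp add: cat_simps)
    then have "(u \<cdot> p) \<cdot> i = Zero C M T" using b T by (simp add: cat_simps)
    then show "u = Zero C M T" using u b by (simp add: cat_simps)
  qed
  ultimately show ?thesis using that pb by blast
qed

text \<open>In a diagram chase this stands for choosing a preimage of \<open>t\<close> under \<open>\<alpha>\<close>: the choice exists
  after passing to an epimorphic cover of the domain of \<open>t\<close>.\<close>

lemma epi_cover:
  assumes "is_epi C \<alpha>" "\<alpha> \<in> Hom C X A" "t \<in> Hom C T A"
  obtains P e s where "e \<in> Hom C P T" "is_epi C e" "s \<in> Hom C P X" "\<alpha> \<cdot> s = t \<cdot> e"
proof -
  obtain P e s where "is_pullback t \<alpha> P e s" "is_epi C e"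
    using pullback_exists[OF assms(3,2)] assms(1) by metis
  then show ?thesis using that Hom_Dom[OF assms(2)] Hom_Dom[OF assms(3)]
    unfolding is_pullback_def by metis
qed

text \<open>The pair \<open>(0, i)\<close> induces \<open>\<kappa> : K \<rightarrow> P\<close>; the projection \<open>b\<close> identifies arrows into \<open>P\<close> killed by \<open>a\<close>
  with arrows into \<open>B\<close> killed by \<open>p\<close>.\<close>

lemma pullback_ses:
  assumes s: "ses C K i B p D" and pb: "is_pullback f p P a b" and f: "f \<in> Hom C V D"
    and epi: "is_epi C a"
  obtains \<kappa> where "ses C K \<kappa> P a V"
proof -
  note S = sesD[OF s]
  have d: "Dom C f = V" "Dom C p = B" using f S by (auto simp: Hom_def)
  have a: "a \<in> Hom C P V" and b: "b \<in> Hom C P B" and eq: "f \<cdot> a = p \<cdot> b"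
    using pb unfolding is_pullback_def d by auto
  have V: "V \<in> Obj C" using f Hom_Obj by blast
  have z: "Zero C K V \<in> Hom C K V" using Zero_in_Hom S V by simp
  have "f \<cdot> Zero C K V = p \<cdot> i" using S f by (simp add: cat_simps)
  then obtain \<kappa> where k: "\<kappa> \<in> Hom C K P" "a \<cdot> \<kappa> = Zero C K V" "b \<cdot> \<kappa> = i"
    using pb z S(1) unfolding is_pullback_def d by metis
  have "ses C K \<kappa> P a V"
  proof (rule sesI[OF k(1) a k(2) _ epi])
    show "is_mono C \<kappa>"
    proof (rule is_monoI[OF k(1)])
      fix T u assume u: "u \<in> Hom C T K" "\<kappa> \<cdot> u = Zero C T P"
      have "i \<cdot> u = b \<cdot> (\<kappa> \<cdot> u)" using k(3) Comp_assoc[OF u(1) k(1) b] by simp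
      also have "\<dots> = Zero C T B" using u b Hom_Obj[OF u(1)] by (simp add: cat_simps)
      finally show "u = Zero C T K" using is_mono_Zero[OF ses_mono[OF s] S(1) u(1)] by simp
    qed
    fix T g assume g: "g \<in> Hom C T P" "a \<cdot> g = Zero C T V"
    have T: "T \<in> Obj C" using g Hom_Obj by blast
    have "p \<cdot> (b \<cdot> g) = (f \<cdot> a) \<cdot> g" using Comp_assoc[OF g(1) b S(2)] eq by simp
    also have "\<dots> = f \<cdot> (a \<cdot> g)" by (rule Comp_assoc[OF g(1) a f])
    also have "\<dots> = Zero C T D" using g f T by (simp add: cat_simps)
    finally obtain h where h: "h \<in> Hom C T K" "i \<cdot> h = b \<cdot> g"
      using ses_lift[OF s Comp_in_Hom[OF g(1) b]] by blast
    let ?d = "\<kappa> \<cdot> h \<oplus>\<^sub>c neg C g"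
    have kh: "\<kappa> \<cdot> h \<in> Hom C T P" using Comp_in_Hom h k by blast
    have d: "?d \<in> Hom C T P" using kh g by (simp add: cat_simps)
    have "a \<cdot> ?d = Zero C T V"
      using a k h g T V S by (simp add: cat_simps Comp_assoc_eq[OF k(2)])
    moreover have "b \<cdot> ?d = Zero C T B"
      using b k h g T V S by (simp add: cat_simps Comp_assoc_eq[OF k(3)])
    ultimately have "?d = Zero C T P"
      using pb d unfolding is_pullback_def \<open>Dom C f = V\<close> \<open>Dom C p = B\<close> by blast
    then show "\<exists>h\<in>Hom C T K. \<kappa> \<cdot> h = g" using eq_if_Add_neg_Zero[OF kh g(1)] h(1) by blast
  qed
  then show ?thesis by (rule that)
qed

end

section \<open>Vanishing of Ext in degree one\<close>

text \<open>\<open>Ext\<^sup>1(V, M) = 0\<close> in the form in which it is used: every extension of \<open>V\<close> by \<open>M\<close> splits. Asking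
  for a retraction rather than a section is immaterial by the next lemma, which makes the notion
  self-dual.\<close>

definition ext1 :: "('o, 'm, 'b) preadd_cat_scheme \<Rightarrow> 'o \<Rightarrow> 'o \<Rightarrow> bool"
  where "ext1 C V M \<longleftrightarrow>
    (\<forall>i E p. ses C M i E p V \<longrightarrow> (\<exists>r \<in> Hom C E M. r \<cdot>\<^bsub>C\<^esub> i = Idm C M))"

context abelian_category
begin

text \<open>The idempotent \<open>1 - i r\<close> kills \<open>i\<close>, hence factors through \<open>p\<close>; the factor is the section.\<close>

lemma section_of_retraction:
  assumes s: "ses C A i B p D" and r: "r \<in> Hom C B A" "r \<cdot> i = Idm C A"
  shows "\<exists>t \<in> Hom C D B. p \<cdot> t = Idm C D"
proof -
  note S = sesD[OF s]
  let ?u = "Idm C B \<oplus>\<^sub>c neg C (i \<cdot> r)"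
  have u: "?u \<in> Hom C B B" using S r(1) by (simp add: cat_simps)
  have "?u \<cdot> i = Zero C A B" using S r by (simp add: cat_simps)
  then obtain t where t: "t \<in> Hom C D B" "t \<cdot> p = ?u" using ses_colift[OF s u] by blast
  have "(p \<cdot> t) \<cdot> p = p \<cdot> ?u" using Comp_assoc[OF S(2) t(1) S(2)] t(2) by simp
  also have "\<dots> = p" using S r by (simp add: cat_simps Comp_assoc_eq[OF S(3)])
  finally have "p \<cdot> t = Idm C D"
    using is_epi_cancel[OF ses_epi[OF s] S(2), of "p \<cdot> t" D "Idm C D"] t(1) S by (simp add: cat_simps)
  then show ?thesis using t(1) by blast
qed

lemmas retraction_of_section = abelian_category.section_of_retraction[OF op, simplified]

lemma op_ext1 [simp]: "ext1 (op C) M V = ext1 C V M"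
  unfolding ext1_def using section_of_retraction retraction_of_section by simp meson

text \<open>Pulling the sequence back along \<open>f\<close> gives an extension of \<open>V\<close> by \<open>M\<close>; a section of it yields
  the lift.\<close>

lemma ext1_lift:
  assumes e: "ext1 C V M" and s: "ses C M i B p D" and f: "f \<in> Hom C V D"
  obtains g where "g \<in> Hom C V B" "p \<cdot> g = f"
proof -
  note S = sesD[OF s]
  obtain P a b where pb: "is_pullback f p P a b" and epi: "is_epi C a"
    using pullback_exists[OF f S(2)] ses_epi[OF s] by metis
  obtain \<kappa> where k: "ses C M \<kappa> P a V" using pullback_ses[OF s pb f epi] .
  then obtain t where t: "t \<in> Hom C V P" "a \<cdot> t = Idm C V"
    using e section_of_retraction[OF k] unfolding ext1_def by blast
  have ab: "a \<in> Hom C P V" "b \<in> Hom C P B" "f \<cdot> a = p \<cdot> b"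
    using pb f S(2) unfolding is_pullback_def by (auto simp: Hom_def)
  have "p \<cdot> (b \<cdot> t) = (f \<cdot> a) \<cdot> t" using Comp_assoc[OF t(1) ab(2) S(2)] ab(3) by simp
  also have "\<dots> = f" using t ab(1) f by (simp add: cat_simps)
  finally show ?thesis using that[OF Comp_in_Hom[OF t(1) ab(2)]] by blast
qed

lemmas ext1_extend = abelian_category.ext1_lift[OF op, simplified]

text \<open>For an extension \<open>K \<rightarrow> E \<rightarrow> V\<close>, extend \<open>K \<rightarrow> P\<close> to \<open>E\<close> and compose with \<open>r\<close>.\<close>

lemma ext1_retract:
  assumes e: "ext1 C V P" and k: "k \<in> Hom C K P" and r: "r \<in> Hom C P K" "r \<cdot> k = Idm C K"
  shows "ext1 C V K"
  unfolding ext1_def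
proof (intro allI impI)
  fix i E p assume s: "ses C K i E p V"
  note S = sesD[OF s]
  obtain g where g: "g \<in> Hom C E P" "g \<cdot> i = k" using ext1_extend[OF e s k] .
  then have "(r \<cdot> g) \<cdot> i = Idm C K" using r S by (simp add: cat_simps)
  then show "\<exists>r\<in>Hom C E K. r \<cdot> i = Idm C K" using Comp_in_Hom[OF g(1) r(1)] by blast
qed

text \<open>The part \<open>Hom(V, X) \<rightarrow> Hom(V, N) \<rightarrow> Ext\<^sup>1(V, M) \<rightarrow> Ext\<^sup>1(V, X) = 0\<close> of the long exact sequence, done
  by hand: extend \<open>j\<close> to \<open>h : E \<rightarrow> X\<close>, and correct \<open>h\<close> by a map that vanishes on \<open>M\<close> so that it lands in
  the subobject \<open>M\<close>. The corrected map is a retraction.\<close>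

lemma ext1_by_lifting:
  assumes s: "ses C M j X q N" and e: "ext1 C V X"
    and lift: "\<And>f. f \<in> Hom C V N \<Longrightarrow> \<exists>g \<in> Hom C V X. q \<cdot> g = f"
  shows "ext1 C V M"
  unfolding ext1_def
proof (intro allI impI)
  fix i E p assume t: "ses C M i E p V"
  note S = sesD[OF s] and T = sesD[OF t]
  obtain h where h: "h \<in> Hom C E X" "h \<cdot> i = j" using ext1_extend[OF e t S(1)] .
  have "(q \<cdot> h) \<cdot> i = Zero C M N" using h S T by (simp add: cat_simps)
  then obtain f where f: "f \<in> Hom C V N" "f \<cdot> p = q \<cdot> h"
    using ses_colift[OF t Comp_in_Hom[OF h(1) S(2)]] by blast
  obtain g where g: "g \<in> Hom C V X" "q \<cdot> g = f" using lift[OF f(1)] by blast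
  let ?d = "h \<oplus>\<^sub>c neg C (g \<cdot> p)"
  have d: "?d \<in> Hom C E X" using h g T by (simp add: cat_simps)
  have "q \<cdot> ?d = Zero C E N" using h g f(1) T S f(2) by (simp add: cat_simps Comp_assoc_eq[OF g(2)])
  then obtain r where r: "r \<in> Hom C E M" "j \<cdot> r = ?d" using ses_lift[OF s d] by blast
  have "j \<cdot> (r \<cdot> i) = ?d \<cdot> i" using Comp_assoc[OF T(1) r(1) S(1)] r(2) by simp
  also have "\<dots> = j \<cdot> Idm C M" using h g S T by (simp add: cat_simps)
  finally have "r \<cdot> i = Idm C M"
    using is_mono_cancel[OF ses_mono[OF s] S(1) Comp_in_Hom[OF T(1) r(1)]] Idm_in_Hom[OF S(4)] by blast
  then show "\<exists>r\<in>Hom C E M. r \<cdot> i = Idm C M" using r(1) by blast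
qed

text \<open>Given an extension \<open>B \<rightarrow> E \<rightarrow> V\<close>, extend \<open>q : B \<rightarrow> D\<close> to \<open>h : E \<rightarrow> D\<close>. The map \<open>(h, p) : E \<rightarrow> D \<oplus> V\<close> is epi
  with kernel \<open>A\<close>, so the inclusion of \<open>V\<close> lifts along it because \<open>Ext\<^sup>1(V, A) = 0\<close>, and the lift is
  a section of \<open>p\<close>.\<close>

lemma ext1_extension:
  assumes s: "ses C A j B q D" and eA: "ext1 C V A" and eD: "ext1 C V D"
  shows "ext1 C V B"
  unfolding ext1_def
proof (intro allI impI)
  fix i E p assume t: "ses C B i E p V"
  note S = sesD[OF s] and T = sesD[OF t]
  obtain h where h: "h \<in> Hom C E D" "h \<cdot> i = q" using ext1_extend[OF eD t S(2)] .
  obtain Q i1 i2 p1 p2 where bi: "is_biproduct C D V Q i1 i2 p1 p2"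
    using biproduct_exists[OF S(6) T(6)] by blast
  note b = is_biproductD[OF bi]
  note r = Comp_assoc_eq[OF b(5)] Comp_assoc_eq[OF b(6)] Comp_assoc_eq[OF b(7)] Comp_assoc_eq[OF b(8)]
  let ?m = "i1 \<cdot> h \<oplus>\<^sub>c i2 \<cdot> p"
  have m: "?m \<in> Hom C E Q" using b h T by (simp add: cat_simps)
  have p1m: "p1 \<cdot> ?m = h" and p2m: "p2 \<cdot> ?m = p" using b(1-4) b(5-) h(1) T by (simp_all add: cat_simps r)
  have ij: "i \<cdot> j \<in> Hom C A E" using Comp_in_Hom S T by blast
  have mij: "?m \<cdot> (i \<cdot> j) = Zero C A Q"
    using b(1,2,10-) h S T by (simp add: cat_simps Comp_assoc_eq[OF h(2)] Comp_assoc_eq[OF T(3)])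
  have "ses C A (i \<cdot> j) E ?m Q"
  proof (rule sesI[OF ij m mij])
    show "is_mono C (i \<cdot> j)"
    proof (rule is_monoI[OF ij])
      fix T u assume u: "u \<in> Hom C T A" "i \<cdot> j \<cdot> u = Zero C T E"
      have "j \<cdot> u = Zero C T B"
        using is_mono_Zero[OF ses_mono[OF t] \<open>i \<in> Hom C B E\<close> Comp_in_Hom[OF u(1) S(1)]] u(2)
          Comp_assoc[OF u(1) S(1) \<open>i \<in> Hom C B E\<close>] by simp
      then show "u = Zero C T A" using is_mono_Zero[OF ses_mono[OF s] S(1) u(1)] by simp
    qed
    show "is_epi C ?m"
    proof (rule is_epiI[OF m])
      fix X u assume u: "u \<in> Hom C Q X" "u \<cdot> ?m = Zero C E X"
      have X: "X \<in> Obj C" using u Hom_Obj by blast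
      let ?u1 = "u \<cdot> i1" and ?u2 = "u \<cdot> i2"
      have u12: "?u1 \<in> Hom C D X" "?u2 \<in> Hom C V X" using u b Comp_in_Hom by auto
      have e: "?u1 \<cdot> h \<oplus>\<^sub>c ?u2 \<cdot> p = Zero C E X" using u b h T by (simp add: cat_simps)
      have "?u1 \<cdot> q = (?u1 \<cdot> h \<oplus>\<^sub>c ?u2 \<cdot> p) \<cdot> i"
        using u(1) b(1,2) h T S X by (simp add: cat_simps)
      also have "\<dots> = Zero C B X" unfolding e using T X by (simp add: cat_simps)
      finally have 1: "?u1 = Zero C D X" using is_epi_Zero[OF ses_epi[OF s] S(2) u12(1)] by simp
      have "?u2 \<cdot> p = Zero C E X" using e unfolding 1 using u b h T X by (simp add: cat_simps)
      then have 2: "?u2 = Zero C V X" using is_epi_Zero[OF ses_epi[OF t] T(2) u12(2)] by simp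
      have "u = u \<cdot> (i1 \<cdot> p1 \<oplus>\<^sub>c i2 \<cdot> p2)" using b u by (simp add: cat_simps)
      also have "\<dots> = ?u1 \<cdot> p1 \<oplus>\<^sub>c ?u2 \<cdot> p2" using b(1-4) u by (simp add: cat_simps)
      also have "\<dots> = Zero C Q X" unfolding 1 2 using b X by (simp add: cat_simps)
      finally show "u = Zero C Q X" .
    qed
    fix X g assume g: "g \<in> Hom C X E" "?m \<cdot> g = Zero C X Q"
    have X: "X \<in> Obj C" using g Hom_Obj by blast
    have "p \<cdot> g = p2 \<cdot> (?m \<cdot> g)" using Comp_assoc[OF g(1) m b(4)] p2m by simp
    also have "\<dots> = Zero C X V" using g b X by (simp add: cat_simps)
    finally obtain y where y: "y \<in> Hom C X B" "i \<cdot> y = g" using ses_lift[OF t g(1)] by blast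
    have "q \<cdot> y = h \<cdot> g" using y h S T Comp_assoc[OF y(1) T(1) h(1)] by simp
    also have "\<dots> = p1 \<cdot> (?m \<cdot> g)" using Comp_assoc[OF g(1) m b(3)] p1m by simp
    also have "\<dots> = Zero C X D" using g b X by (simp add: cat_simps)
    finally obtain x where x: "x \<in> Hom C X A" "j \<cdot> x = y" using ses_lift[OF s y(1)] by blast
    then show "\<exists>h\<in>Hom C X A. (i \<cdot> j) \<cdot> h = g" using Comp_assoc[OF x(1) S(1) T(1)] y(2) by auto
  qed
  from ext1_lift[OF eA this b(2)] obtain g where g: "g \<in> Hom C V E" "?m \<cdot> g = i2" .
  have "p \<cdot> g = p2 \<cdot> (?m \<cdot> g)" using Comp_assoc[OF g(1) m b(4)] p2m by simp
  then have "p \<cdot> g = Idm C V" using g b(6) by simp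
  then show "\<exists>r\<in>Hom C E B. r \<cdot> i = Idm C B" using retraction_of_section[OF t g(1)] by blast
qed

lemmas ext1_coretract = abelian_category.ext1_retract[OF op, simplified]
lemmas ext1_by_extending = abelian_category.ext1_by_lifting[OF op, simplified]
lemmas ext1_coextension = abelian_category.ext1_extension[OF op, simplified]

text \<open>It remains to connect \<^const>\<open>ext1\<close> with Yoneda extensions of length one.\<close>

lemma ses_extension: "ses C B i E p A \<Longrightarrow> [i, p] \<in> extensions C 1 A B"
  unfolding extensions_def exact_at_def
  using ses_mono[of B i E p A] ses_epi[of B i E p A]
  by (auto simp: ses_def Hom_def)

lemma extension_ses:
  assumes e: "e \<in> extensions C 1 A B"
  shows "ses C B (e ! 0) (Cod C (e ! 0)) (e ! 1) A"
proof -
  from e obtain p k where *: "is_mono C (e ! 0)" "is_epi C (e ! 1)" "Dom C (e ! 0) = B" "Cod C (e ! 1) = A"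
    "is_cokernel C (e ! 0) p" "is_kernel C p k" "is_kernel C (e ! 1) k"
    by (auto simp: extensions_def exact_at_def)
  let ?i = "e ! 0" and ?q = "e ! 1" and ?X = "Cod C (e ! 0)"
  have ker: "is_kernel C p ?i" using mono_kernel_of_cokernel[OF *(1,5)] .
  have i: "?i \<in> Hom C B ?X" and p: "p \<in> Hom C ?X (Cod C p)" and k: "k \<in> Hom C (Dom C k) ?X"
    and q: "?q \<in> Hom C ?X A" and pi: "p \<cdot> ?i = Zero C B (Cod C p)" 
    and qk: "?q \<cdot> k = Zero C (Dom C k) A" and pk: "p \<cdot> k = Zero C (Dom C k) (Cod C p)"
    using * by (auto simp: is_kernel_def is_cokernel_def Hom_def)
  obtain h where h: "h \<in> Hom C B (Dom C k)" "k \<cdot> h = ?i" using is_kernel_lift[OF *(6) p i pi] .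
  have qi: "?q \<cdot> ?i = Zero C B A"
    using Comp_assoc[OF h(1) k q] h qk Hom_Obj[OF q] by (simp add: cat_simps)
  show ?thesis
  proof (rule sesI[OF i q qi *(1,2)])
    fix T g assume g: "g \<in> Hom C T ?X" "?q \<cdot> g = Zero C T A"
    obtain y where y: "y \<in> Hom C T (Dom C k)" "k \<cdot> y = g" using is_kernel_lift[OF *(7) q g] .
    have "p \<cdot> g = Zero C T (Cod C p)"
      using Comp_assoc[OF y(1) k p] y pk Hom_Obj[OF p] by (simp add: cat_simps)
    from is_kernel_lift[OF ker p g(1) this] show "\<exists>h\<in>Hom C T B. e ! 0 \<cdot> h = g" using *(3) by blast
  qed
qed

text \<open>Sections are transported forward and retractions backward along a morphism of extensions.\<close>

lemma split_extension_morphism: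
  assumes "(e, e') \<in> extension_morphism C 1 A B"
  shows "(\<exists>r \<in> Hom C (Cod C (e ! 0)) B. r \<cdot> (e ! 0) = Idm C B) \<longleftrightarrow>
    (\<exists>r \<in> Hom C (Cod C (e' ! 0)) B. r \<cdot> (e' ! 0) = Idm C B)"
proof -
  let ?i = "e ! 0" and ?q = "e ! 1" and ?X = "Cod C (e ! 0)"
  let ?i' = "e' ! 0" and ?q' = "e' ! 1" and ?X' = "Cod C (e' ! 0)"
  from assms have s: "ses C B ?i ?X ?q A" and s': "ses C B ?i' ?X' ?q' A"
    using extension_ses by (auto simp: extension_morphism_def)
  note S = sesD[OF s] and S' = sesD[OF s']
  from assms obtain h where h: "h 0 = Idm C B" "h (Suc 1) = Idm C A"
    "\<forall>i \<le> 1. h i \<in> Hom C (Dom C (e ! i)) (Dom C (e' ! i)) \<and>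
               h (Suc i) \<cdot> (e ! i) = (e' ! i) \<cdot> h i"
    unfolding extension_morphism_def by blast
  have h0: "h (Suc 0) \<cdot> ?i = ?i' \<cdot> h 0" and h1: "h (Suc 1) \<cdot> ?q = ?q' \<cdot> h 1"
    and hH: "h 1 \<in> Hom C (Dom C ?q) (Dom C ?q')"
    using h(3) by auto
  have f: "h 1 \<in> Hom C ?X ?X'" using hH S(2) S'(2) by (simp add: Hom_def)
  have fi: "h 1 \<cdot> ?i = ?i'" using h0 h(1) S'(1) by (simp add: cat_simps)
  have qf: "?q' \<cdot> h 1 = ?q" using h1 h(2) S(2) by (simp add: cat_simps)
  show ?thesis
  proof
    assume "\<exists>r \<in> Hom C ?X B. r \<cdot> ?i = Idm C B"
    then obtain t where t: "t \<in> Hom C A ?X" "?q \<cdot> t = Idm C A"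
      using section_of_retraction[OF s] by blast
    have "?q' \<cdot> (h 1 \<cdot> t) = Idm C A" using Comp_assoc[OF t(1) f S'(2)] qf t(2) by simp
    then show "\<exists>r \<in> Hom C ?X' B. r \<cdot> ?i' = Idm C B"
      using retraction_of_section[OF s' Comp_in_Hom[OF t(1) f]] by blast
  next
    assume "\<exists>r \<in> Hom C ?X' B. r \<cdot> ?i' = Idm C B"
    then obtain r where r: "r \<in> Hom C ?X' B" "r \<cdot> ?i' = Idm C B" by blast
    then have "(r \<cdot> h 1) \<cdot> ?i = Idm C B" using Comp_assoc[OF S(1) f r(1)] fi by simp
    then show "\<exists>r \<in> Hom C ?X B. r \<cdot> ?i = Idm C B" using Comp_in_Hom[OF f r(1)] by blast
  qed
qed

lemma biproduct_ses:
  assumes "is_biproduct C A B P i j p q"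
  shows "ses C A i P q B"
proof -
  note b = is_biproductD[OF assms]
  show ?thesis
  proof (rule sesI[OF b(1,4,7)])
    show "is_mono C i"
    proof (rule is_monoI[OF b(1)])
      fix T u assume u: "u \<in> Hom C T A" "i \<cdot> u = Zero C T P"
      have "u = p \<cdot> (i \<cdot> u)" using u(1) b(1,3) by (simp add: cat_simps Comp_assoc_eq[OF b(5)])
      then show "u = Zero C T A" unfolding u(2) using b u Hom_Obj[OF u(1)] by (simp add: cat_simps)
    qed
    show "is_epi C q"
    proof (rule is_epiI[OF b(4)])
      fix T u assume u: "u \<in> Hom C B T" "u \<cdot> q = Zero C P T"
      have "u = (u \<cdot> q) \<cdot> j" using u(1) b(2,4,6) by (simp add: cat_simps)
      then show "u = Zero C B T" unfolding u(2) using b Hom_Obj[OF u(1)] by (simp add: cat_simps)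
    qed
    fix T g assume g: "g \<in> Hom C T P" "q \<cdot> g = Zero C T B"
    have "g = i \<cdot> (p \<cdot> g)"
      using biproduct_arrow_eq[OF assms g(1)] g b(1-4,10-) Hom_Obj(1)[OF g(1)]
      by (simp add: cat_simps)
    then show "\<exists>h\<in>Hom C T A. i \<cdot> h = g" using Comp_in_Hom[OF g(1) b(3)] by metis
  qed
qed

text \<open>If there is only one class of extensions, then each of them is connected by morphisms to the
  split one, and splitting is invariant along such a chain.\<close>

lemma ext1_if_Ext_vanishes:
  assumes van: "Ext_vanishes C 1 V M" and ob: "V \<in> Obj C" "M \<in> Obj C"
  shows "ext1 C V M"
  unfolding ext1_def
proof (intro allI impI)
  fix i E p assume s: "ses C M i E p V"
  let ?R = "extension_morphism C 1 V M \<union> (extension_morphism C 1 V M)\<inverse>"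
  let ?S = "\<lambda>e. \<exists>r \<in> Hom C (Cod C (e ! 0)) M. r \<cdot> (e ! 0) = Idm C M"
  obtain P a b c d where bi: "is_biproduct C M V P a b c d" using biproduct_exists ob by blast
  have e: "[i, p] \<in> extensions C 1 V M" "[a, d] \<in> extensions C 1 V M"
    using ses_extension s biproduct_ses[OF bi] by auto
  obtain x where x: "extensions C 1 V M // ?R\<^sup>* = {x}"
    using van unfolding Ext_vanishes_def Ext_def is_singleton_def by blast
  have "?R\<^sup>* `` {[i, p]} = ?R\<^sup>* `` {[a, d]}"
    using quotientI[OF e(1), of "?R\<^sup>*"] quotientI[OF e(2), of "?R\<^sup>*"] unfolding x by simp
  then have "([a, d], [i, p]) \<in> ?R\<^sup>*" by blast
  then have "?S [a, d] \<longleftrightarrow> ?S [i, p]"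
  proof (induction rule: rtrancl_induct)
    case (step y z)
    have "?S y \<longleftrightarrow> ?S z" using step.hyps(2) split_extension_morphism by blast
    with step.IH show ?case by simp
  qed simp
  then show "\<exists>r \<in> Hom C E M. r \<cdot> i = Idm C M"
    using is_biproductD(1,3,5)[OF bi] sesD(1)[OF s] by (auto simp: Hom_def)
qed

end

section \<open>Diagram lemmas\<close>

context preadditive_category
begin

lemma is_mono_Comp:
  assumes "f \<in> Hom C A B" "g \<in> Hom C B D" "is_mono C f" "is_mono C g"
  shows "is_mono C (g \<cdot> f)"
proof (rule is_monoI[OF Comp_in_Hom[OF assms(1,2)]])
  fix T u assume u: "u \<in> Hom C T A" "(g \<cdot> f) \<cdot> u = Zero C T D"
  have "f \<cdot> u = Zero C T B"
    using is_mono_Zero[OF assms(4,2) Comp_in_Hom[OF u(1) assms(1)]] Comp_assoc[OF u(1) assms(1,2)] u(2)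
    by simp
  then show "u = Zero C T A" using is_mono_Zero[OF assms(3,1) u(1)] by simp
qed

lemma is_mono_if_Comp_mono:
  assumes "f \<in> Hom C A B" "g \<in> Hom C B D" "is_mono C (g \<cdot> f)"
  shows "is_mono C f"
proof (rule is_monoI[OF assms(1)])
  fix T u assume u: "u \<in> Hom C T A" "f \<cdot> u = Zero C T B"
  have "(g \<cdot> f) \<cdot> u = Zero C T D"
    using Comp_assoc[OF u(1) assms(1,2)] u assms(2) Hom_Obj[OF u(1)] by (simp add: cat_simps)
  then show "u = Zero C T A" using is_mono_Zero[OF assms(3) Comp_in_Hom[OF assms(1,2)] u(1)] by simp
qed

end

context abelian_category
begin

lemmas is_epi_Comp = preadditive_category.is_mono_Comp[OF op_preadditive, simplified]
lemmas is_epi_if_Comp_epi = preadditive_category.is_mono_if_Comp_mono[OF op_preadditive, simplified]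

text \<open>The kernel \<open>L\<close> of \<open>B \<rightarrow> D \<rightarrow> E\<close> is the preimage of \<open>K\<close> in \<open>B\<close>; it maps onto \<open>K\<close> with the same kernel
  with which \<open>B\<close> maps onto \<open>D\<close>.\<close>

lemma ses_kernel_of_Comp:
  assumes s: "ses C A i B p D" and t: "ses C K a D b E" and l: "ses C L l B (b \<cdot> p) E"
  obtains h g where "ses C A h L g K"
proof -
  note S = sesD[OF s] and T = sesD[OF t] and L = sesD[OF l]
  have "b \<cdot> (p \<cdot> l) = Zero C L E" using Comp_assoc[OF L(1) S(2) T(2)] L(3) by simp
  then obtain g where g: "g \<in> Hom C L K" "a \<cdot> g = p \<cdot> l"
    using ses_lift[OF t Comp_in_Hom[OF L(1) S(2)]] by blast
  have "(b \<cdot> p) \<cdot> i = Zero C A E" using S T by (simp add: cat_simps)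
  then obtain h where h: "h \<in> Hom C A L" "l \<cdot> h = i" using ses_lift[OF l S(1)] by blast
  have "a \<cdot> (g \<cdot> h) = p \<cdot> (l \<cdot> h)"
    using Comp_assoc[OF h(1) g(1) T(1)] Comp_assoc[OF h(1) L(1) S(2)] g(2) by simp
  then have gh: "g \<cdot> h = Zero C A K"
    using is_mono_Zero[OF ses_mono[OF t] T(1) Comp_in_Hom[OF h(1) g(1)]] h(2) S(3) by simp
  have hm: "is_mono C h"
    using is_mono_if_Comp_mono[OF h(1) L(1)] h(2) ses_mono[OF s] by simp
  obtain P e y where e: "e \<in> Hom C P K" "is_epi C e" "y \<in> Hom C P B" "p \<cdot> y = a \<cdot> e"
    using epi_cover[OF ses_epi[OF s] S(2) T(1)] .
  have "(b \<cdot> p) \<cdot> y = (b \<cdot> a) \<cdot> e"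
    using Comp_assoc[OF e(3) S(2) T(2)] Comp_assoc[OF e(1) T(1,2)] e(4) by simp
  also have "\<dots> = Zero C P E" using T e(1) by (simp add: cat_simps)
  finally obtain z where z: "z \<in> Hom C P L" "l \<cdot> z = y" using ses_lift[OF l e(3)] by blast
  have "a \<cdot> (g \<cdot> z) = p \<cdot> (l \<cdot> z)"
    using Comp_assoc[OF z(1) g(1) T(1)] Comp_assoc[OF z(1) L(1) S(2)] g(2) by simp
  then have "g \<cdot> z = e"
    using is_mono_cancel[OF ses_mono[OF t] T(1) Comp_in_Hom[OF z(1) g(1)] e(1)] z(2) e(4) by simp
  then have ge: "is_epi C g" using is_epi_if_Comp_epi[OF g(1) z(1)] e(2) by simp
  have "ses C A h L g K"
  proof (rule sesI[OF h(1) g(1) gh hm ge])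
    fix T u assume u: "u \<in> Hom C T L" "g \<cdot> u = Zero C T K"
    have lu: "l \<cdot> u \<in> Hom C T B" using Comp_in_Hom[OF u(1) L(1)] .
    have "p \<cdot> (l \<cdot> u) = a \<cdot> (g \<cdot> u)"
      using Comp_assoc[OF u(1) g(1) T(1)] Comp_assoc[OF u(1) L(1) S(2)] g(2) by simp
    also have "\<dots> = Zero C T D" using u T(1) Hom_Obj[OF u(1)] by (simp add: cat_simps)
    finally obtain x where x: "x \<in> Hom C T A" "i \<cdot> x = l \<cdot> u" using ses_lift[OF s lu] by blast
    have "l \<cdot> (h \<cdot> x) = l \<cdot> u" using Comp_assoc[OF x(1) h(1) L(1)] h(2) x(2) by simp
    then have "h \<cdot> x = u"
      using is_mono_cancel[OF ses_mono[OF l] L(1) Comp_in_Hom[OF x(1) h(1)] u(1)] by simp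
    then show "\<exists>x\<in>Hom C T A. h \<cdot> x = u" using x(1) by blast
  qed
  then show ?thesis by (rule that)
qed

text \<open>The hypothesis on \<open>XD\<close> replaces projectivity: it suffices to lift \<open>\<pi> : XD \<rightarrow> D\<close> to
  \<open>\<gamma> : XD \<rightarrow> B\<close>. Then \<open>\<phi> = (j \<alpha>, \<gamma>)\<close> is epi, and its kernel is an extension of \<open>D'\<close> by \<open>A'\<close>.\<close>

lemma horseshoe:
  assumes s: "ses C A j B q D" and sA: "ses C A' iA XA \<alpha> A" and sD: "ses C D' iD XD \<pi> D"
    and e: "ext1 C XD A" and bi: "is_biproduct C XA XD X i1 i2 p1 p2"
  obtains B' k \<phi> h g where "ses C B' k X \<phi> B" "ses C A' h B' g D'"
proof -
  note S = sesD[OF s] and SA = sesD[OF sA] and SD = sesD[OF sD] and b = is_biproductD[OF bi]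
  note r = Comp_assoc_eq[OF b(5)] Comp_assoc_eq[OF b(6)] Comp_assoc_eq[OF b(7)] Comp_assoc_eq[OF b(8)]
  obtain \<gamma> where c: "\<gamma> \<in> Hom C XD B" "q \<cdot> \<gamma> = \<pi>" using ext1_lift[OF e s SD(2)] .
  define \<phi> where "\<phi> = (j \<cdot> \<alpha>) \<cdot> p1 \<oplus>\<^sub>c \<gamma> \<cdot> p2"
  have f: "\<phi> \<in> Hom C X B" unfolding \<phi>_def using S(1) SA(2) b(3,4) c(1) by (simp add: cat_simps)
  have f1: "\<phi> \<cdot> i1 = j \<cdot> \<alpha>" and f2: "\<phi> \<cdot> i2 = \<gamma>"
    unfolding \<phi>_def using S(1) SA(2) b(1-8,10-) c(1) S(4,5) by (simp_all add: cat_simps)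
  have qf: "q \<cdot> \<phi> = \<pi> \<cdot> p2"
    unfolding \<phi>_def using S(1-6) SA(2) SD(2) b(3,4,12) c
    by (simp add: cat_simps Comp_assoc_eq[OF c(2)] Comp_assoc_eq[OF S(3)])
  have fe: "is_epi C \<phi>"
  proof (rule is_epiI[OF f])
    fix T u assume u: "u \<in> Hom C B T" "u \<cdot> \<phi> = Zero C X T"
    have T: "T \<in> Obj C" using u Hom_Obj by blast
    have "(u \<cdot> j) \<cdot> \<alpha> = (u \<cdot> \<phi>) \<cdot> i1"
      using Comp_assoc[OF b(1) f u(1)] Comp_assoc[OF SA(2) S(1) u(1)] f1 by simp
    also have "\<dots> = Zero C XA T" using u b(1) T by (simp add: cat_simps)
    finally have "u \<cdot> j = Zero C A T"
      using is_epi_Zero[OF ses_epi[OF sA] SA(2) Comp_in_Hom[OF S(1) u(1)]] by simp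
    then obtain v where v: "v \<in> Hom C D T" "v \<cdot> q = u" using ses_colift[OF s u(1)] by blast
    have "v \<cdot> \<pi> = (u \<cdot> \<phi>) \<cdot> i2"
      using Comp_assoc[OF b(2) f u(1)] f2 Comp_assoc[OF c(1) S(2) v(1)] c(2) v(2) by simp
    also have "\<dots> = Zero C XD T" using u b(2) T by (simp add: cat_simps)
    finally have "v = Zero C D T" using is_epi_Zero[OF ses_epi[OF sD] SD(2) v(1)] by simp
    then show "u = Zero C B T" using v(2) S(2) T by (simp add: cat_simps)
  qed
  obtain B' k where k: "ses C B' k X \<phi> B" using epi_ses[OF fe f] .
  note K = sesD[OF k]
  have "\<pi> \<cdot> (p2 \<cdot> k) = (\<pi> \<cdot> p2) \<cdot> k" using Comp_assoc[OF K(1) b(4) SD(2)] by simp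
  also have "\<dots> = q \<cdot> (\<phi> \<cdot> k)" using Comp_assoc[OF K(1) f S(2)] qf by simp
  also have "\<dots> = Zero C B' D" unfolding K(3) using S(2) K by (simp add: cat_simps)
  finally obtain g where g: "g \<in> Hom C B' D'" "iD \<cdot> g = p2 \<cdot> k"
    using ses_lift[OF sD Comp_in_Hom[OF K(1) b(4)]] by blast
  have i1A: "i1 \<cdot> iA \<in> Hom C A' X" using Comp_in_Hom[OF SA(1) b(1)] .
  have "\<phi> \<cdot> (i1 \<cdot> iA) = (j \<cdot> \<alpha>) \<cdot> iA" using Comp_assoc[OF SA(1) b(1) f] f1 by simp
  also have "\<dots> = Zero C A' B" using S(1) SA by (simp add: cat_simps)
  finally obtain h where h: "h \<in> Hom C A' B'" "k \<cdot> h = i1 \<cdot> iA" using ses_lift[OF k i1A] by blast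
  have "iD \<cdot> (g \<cdot> h) = p2 \<cdot> (k \<cdot> h)"
    using Comp_assoc[OF h(1) g(1) SD(1)] Comp_assoc[OF h(1) K(1) b(4)] g(2) by simp
  also have "\<dots> = Zero C A' XD" unfolding h(2) using b SA(1,4) by (simp add: cat_simps r)
  finally have gh: "g \<cdot> h = Zero C A' D'"
    using is_mono_Zero[OF ses_mono[OF sD] SD(1) Comp_in_Hom[OF h(1) g(1)]] by simp
  have "is_mono C i1" using ses_mono[OF biproduct_ses[OF bi]] .
  then have "is_mono C (k \<cdot> h)" unfolding h(2) using is_mono_Comp[OF SA(1) b(1) ses_mono[OF sA]] by simp
  then have hm: "is_mono C h" using is_mono_if_Comp_mono[OF h(1) K(1)] by simp
  (* D' -> XD -> B lands in A; lifting this map to XA on a cover and subtracting the lift yields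
     a map from the cover into the kernel of phi, which shows that g hits all of D' *)
  have ge: "is_epi C g"
  proof -
    have gi: "\<gamma> \<cdot> iD \<in> Hom C D' B" using Comp_in_Hom[OF SD(1) c(1)] .
    have "q \<cdot> (\<gamma> \<cdot> iD) = Zero C D' D" using Comp_assoc[OF SD(1) c(1) S(2)] c(2) SD(3) by simp
    then obtain t where t: "t \<in> Hom C D' A" "j \<cdot> t = \<gamma> \<cdot> iD" using ses_lift[OF s gi] by blast
    obtain P e y where e: "e \<in> Hom C P D'" "is_epi C e" "y \<in> Hom C P XA" "\<alpha> \<cdot> y = t \<cdot> e"
      using epi_cover[OF ses_epi[OF sA] SA(2) t(1)] .
    let ?w = "i2 \<cdot> (iD \<cdot> e) \<oplus>\<^sub>c neg C (i1 \<cdot> y)"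
    have w: "?w \<in> Hom C P X" using b e SD(1) by (simp add: cat_simps)
    have P: "P \<in> Obj C" using e Hom_Obj by blast
    have "\<phi> \<cdot> ?w = (\<phi> \<cdot> i2) \<cdot> (iD \<cdot> e) \<oplus>\<^sub>c neg C ((\<phi> \<cdot> i1) \<cdot> y)"
      using f b(1,2) e(1,3) SD(1) by (simp add: cat_simps)
    also have "\<dots> = (j \<cdot> t) \<cdot> e \<oplus>\<^sub>c neg C (j \<cdot> (\<alpha> \<cdot> y))"
      unfolding f1 f2 t(2) using c(1) SD(1) SA(2) S(1) e(1,3) by (simp add: cat_simps)
    also have "\<dots> = Zero C P B" unfolding e(4) using t(1) S(1) e(1) by (simp add: cat_simps)
    finally obtain z where z: "z \<in> Hom C P B'" "k \<cdot> z = ?w" using ses_lift[OF k w] by blast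
    have "iD \<cdot> (g \<cdot> z) = p2 \<cdot> ?w"
      using Comp_assoc[OF z(1) g(1) SD(1)] Comp_assoc[OF z(1) K(1) b(4)] g(2) z(2) by simp
    also have "\<dots> = iD \<cdot> e" using b e(1,3) SD(1) P by (simp add: cat_simps r)
    finally have "g \<cdot> z = e"
      using is_mono_cancel[OF ses_mono[OF sD] SD(1) Comp_in_Hom[OF z(1) g(1)] e(1)] by simp
    then show ?thesis using is_epi_if_Comp_epi[OF g(1) z(1)] e(2) by simp
  qed
  have "ses C A' h B' g D'"
  proof (rule sesI[OF h(1) g(1) gh hm ge])
    fix T u assume u: "u \<in> Hom C T B'" "g \<cdot> u = Zero C T D'"
    have T: "T \<in> Obj C" using u Hom_Obj by blast
    have ku: "k \<cdot> u \<in> Hom C T X" using Comp_in_Hom[OF u(1) K(1)] .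
    have "p2 \<cdot> (k \<cdot> u) = iD \<cdot> (g \<cdot> u)"
      using Comp_assoc[OF u(1) K(1) b(4)] Comp_assoc[OF u(1) g(1) SD(1)] g(2) by simp
    also have "\<dots> = Zero C T XD" unfolding u(2) using SD(1) T SD by (simp add: cat_simps)
    finally have ku1: "k \<cdot> u = i1 \<cdot> (p1 \<cdot> (k \<cdot> u))"
      using biproduct_arrow_eq[OF bi ku] ku b(1-4,10-) T by (simp add: cat_simps)
    let ?v = "p1 \<cdot> (k \<cdot> u)"
    have v: "?v \<in> Hom C T XA" using Comp_in_Hom[OF ku b(3)] .
    have "j \<cdot> (\<alpha> \<cdot> ?v) = (\<phi> \<cdot> i1) \<cdot> ?v" using f1 Comp_assoc[OF v SA(2) S(1)] by simp
    also have "\<dots> = \<phi> \<cdot> (k \<cdot> u)" using Comp_assoc[OF v b(1) f] ku1 by simp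
    also have "\<dots> = (\<phi> \<cdot> k) \<cdot> u" using Comp_assoc[OF u(1) K(1) f] by simp
    also have "\<dots> = Zero C T B" unfolding K(3) using u(1) K by (simp add: cat_simps)
    finally have "\<alpha> \<cdot> ?v = Zero C T A"
      using is_mono_Zero[OF ses_mono[OF s] S(1) Comp_in_Hom[OF v SA(2)]] by simp
    then obtain x where x: "x \<in> Hom C T A'" "iA \<cdot> x = ?v" using ses_lift[OF sA v] by blast
    have "k \<cdot> (h \<cdot> x) = k \<cdot> u"
      using Comp_assoc[OF x(1) h(1) K(1)] Comp_assoc[OF x(1) SA(1) b(1)] h(2) x(2) ku1 by simp
    then have "h \<cdot> x = u"
      using is_mono_cancel[OF ses_mono[OF k] K(1) Comp_in_Hom[OF x(1) h(1)] u(1)] by simp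
    then show "\<exists>x\<in>Hom C T A'. h \<cdot> x = u" using x(1) by blast
  qed
  with k show ?thesis by (rule that)
qed

lemma cokernel_iso:
  assumes c: "is_cokernel C d p" and d: "d \<in> Hom C A B" and f: "f \<in> Hom C (Cod C p) M"
    and g: "g \<in> Hom C M (Cod C p)" and gf: "g \<cdot> f = Idm C (Cod C p)" and fg: "f \<cdot> g = Idm C M"
  shows "is_cokernel C d (f \<cdot> p)"
proof -
  have p: "p \<in> Hom C B (Cod C p)" and pd: "p \<cdot> d = Zero C A (Cod C p)"
    using c d by (auto simp: is_cokernel_def Hom_def)
  have fp: "f \<cdot> p \<in> Hom C B M" using Comp_in_Hom[OF p f] .
  show ?thesis
  proof (rule is_cokernelI[OF fp d])
    show "(f \<cdot> p) \<cdot> d = Zero C A M"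
      using Comp_assoc[OF d p f] pd f Hom_Obj[OF d] by (simp add: cat_simps)
    have "is_epi C f"
    proof (rule is_epiI[OF f])
      fix T u assume u: "u \<in> Hom C M T" "u \<cdot> f = Zero C (Cod C p) T"
      have "u = (u \<cdot> f) \<cdot> g" using Comp_assoc[OF g f u(1)] fg u(1) by (simp add: cat_simps)
      then show "u = Zero C M T" unfolding u(2) using g Hom_Obj[OF u(1)] by (simp add: cat_simps)
    qed
    then show "is_epi C (f \<cdot> p)" using is_epi_Comp[OF f p] is_cokernel_epi[OF c] by simp
    fix T u assume u: "u \<in> Hom C B T" "u \<cdot> d = Zero C A T"
    obtain h where h: "h \<in> Hom C (Cod C p) T" "h \<cdot> p = u" using is_cokernel_colift[OF c d u] .
    have "(h \<cdot> g) \<cdot> (f \<cdot> p) = h \<cdot> ((g \<cdot> f) \<cdot> p)"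
      using h(1) g f p by (simp add: cat_simps del: Arr_Idm_left)
    also have "\<dots> = u" unfolding gf using p h by (simp add: cat_simps)
    finally show "\<exists>x\<in>Hom C M T. x \<cdot> (f \<cdot> p) = u" using Comp_in_Hom[OF g h(1)] by blast
  qed
qed

text \<open>The image in \<^const>\<open>exact_at\<close> may be computed from any cokernel.\<close>

lemma exact_at_cokernel:
  assumes "exact_at C f g" "is_cokernel C f p"
  obtains k where "is_kernel C p k" "is_kernel C g k"
proof -
  obtain p0 k where *: "is_cokernel C f p0" "is_kernel C p0 k" "is_kernel C g k"
    using assms(1) by (auto simp: exact_at_def)
  have f: "f \<in> Hom C (Dom C f) (Cod C f)" and p: "p \<in> Hom C (Cod C f) (Cod C p)"
    and p0: "p0 \<in> Hom C (Cod C f) (Cod C p0)" and pf: "p \<cdot> f = Zero C (Dom C f) (Cod C p)"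
    and pf0: "p0 \<cdot> f = Zero C (Dom C f) (Cod C p0)"
    and k: "k \<in> Hom C (Dom C k) (Cod C f)" and p0k: "p0 \<cdot> k = Zero C (Dom C k) (Cod C p0)"
    using * assms(2) by (auto simp: is_cokernel_def is_kernel_def Hom_def)
  obtain u where u: "u \<in> Hom C (Cod C p0) (Cod C p)" "u \<cdot> p0 = p"
    using is_cokernel_colift[OF *(1) f p pf] .
  obtain v where v: "v \<in> Hom C (Cod C p) (Cod C p0)" "v \<cdot> p = p0"
    using is_cokernel_colift[OF assms(2) f p0 pf0] .
  have "is_kernel C p k"
  proof (rule is_kernelI[OF k p _ is_kernel_mono[OF *(2)]])
    show "p \<cdot> k = Zero C (Dom C k) (Cod C p)"
      using Comp_assoc[OF k p0 u(1)] u p0k Hom_Obj[OF k] by (simp add: cat_simps)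
    fix T x assume x: "x \<in> Hom C T (Cod C f)" "p \<cdot> x = Zero C T (Cod C p)"
    have "p0 \<cdot> x = Zero C T (Cod C p0)"
      using Comp_assoc[OF x(1) p v(1)] v x(2) Hom_Obj[OF x(1)] by (simp add: cat_simps)
    from is_kernel_lift[OF *(2) p0 x(1) this] show "\<exists>h\<in>Hom C T (Dom C k). k \<cdot> h = x" by blast
  qed
  with *(3) show ?thesis using that by blast
qed

text \<open>Exactness identifies \<open>p\<close> with the coimage of \<open>d\<close>, and the comparison of the coimage with the
  codomain is mono: lift a map \<open>u\<close> killed by \<open>e\<close> to \<open>B\<close> on a cover; there \<open>d\<close> kills it, so it comes
  from the kernel of \<open>p\<close>.\<close>

lemma exact_at_image_mono:
  assumes ex: "exact_at C d' d" and c: "is_cokernel C d' p" and d: "d \<in> Hom C B D"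
    and e: "e \<in> Hom C (Cod C p) D" "e \<cdot> p = d"
  shows "is_mono C e"
proof (rule is_monoI[OF e(1)])
  obtain k where k: "is_kernel C p k" "is_kernel C d k" using exact_at_cokernel[OF ex c] .
  have p: "p \<in> Hom C B (Cod C p)" using k d by (auto simp: is_kernel_def Hom_def)
  have kH: "k \<in> Hom C (Dom C k) B" and pk: "p \<cdot> k = Zero C (Dom C k) (Cod C p)"
    using k(1) p by (auto simp: is_kernel_def Hom_def)
  fix T u assume u: "u \<in> Hom C T (Cod C p)" "e \<cdot> u = Zero C T D"
  obtain P c y where y: "c \<in> Hom C P T" "is_epi C c" "y \<in> Hom C P B" "p \<cdot> y = u \<cdot> c"
    using epi_cover[OF is_cokernel_epi[OF c] p u(1)] .
  have "d \<cdot> y = e \<cdot> (u \<cdot> c)" using Comp_assoc[OF y(3) p e(1)] e(2) y(4) by simp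
  also have "\<dots> = Zero C P D"
    using Comp_assoc[OF y(1) u(1) e(1)] u(2) y(1) Hom_Obj[OF e(1)] by (simp add: cat_simps)
  finally obtain z where z: "z \<in> Hom C P (Dom C k)" "k \<cdot> z = y" using is_kernel_lift[OF k(2) d y(3)] by blast
  have "u \<cdot> c = Zero C P (Cod C p)"
    using Comp_assoc[OF z(1) kH p] z pk y(4) Hom_Obj[OF p] by (simp add: cat_simps)
  then show "u = Zero C T (Cod C p)" using is_epi_Zero[OF y(2,1) u(1)] by simp
qed

lemmas ses_cokernel_of_Comp = abelian_category.ses_kernel_of_Comp[OF op, simplified]
end

section \<open>Gorenstein objects by coinduction\<close>

definition perp :: "('o, 'm, 'b) preadd_cat_scheme \<Rightarrow> 'o set \<Rightarrow> 'o \<Rightarrow> bool"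
  where "perp C W M \<longleftrightarrow> (\<forall>V \<in> W. ext1 C V M \<and> ext1 C M V)"

definition syzygy :: "('o, 'm, 'b) preadd_cat_scheme \<Rightarrow> 'o set \<Rightarrow> 'o \<Rightarrow> 'o \<Rightarrow> bool"
  where "syzygy C W M' M \<longleftrightarrow> (\<exists>X \<in> W. \<exists>i p. ses C M' i X p M)"

text \<open>The largest class closed under both steps. Orthogonality of the end terms makes
  the short exact sequences exact under \<open>Hom(V, -)\<close> and \<open>Hom(-, V)\<close>; in this way \<^const>\<open>perp\<close> encodes
  the total acyclicity of the complex spliced from them.\<close>

definition gor :: "('o, 'm, 'b) preadd_cat_scheme \<Rightarrow> 'o set \<Rightarrow> 'o \<Rightarrow> bool"
  where "gor C W M \<longleftrightarrow> (\<exists>S. M \<in> S \<and> (\<forall>N \<in> S. perp C W N \<and>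
    (\<exists>N' \<in> S. syzygy C W N' N) \<and> (\<exists>N' \<in> S. syzygy C W N N')))"

lemma gor_coinduct [consumes 1, case_names step]:
  assumes "M \<in> S"
    and "\<And>N. N \<in> S \<Longrightarrow> perp C W N \<and> (\<exists>N' \<in> S. syzygy C W N' N) \<and> (\<exists>N' \<in> S. syzygy C W N N')"
  shows "gor C W M"
  using assms unfolding gor_def by blast

lemma gor_cases:
  assumes "gor C W M"
  obtains M' M'' where "perp C W M" "syzygy C W M' M" "gor C W M'" "syzygy C W M M''" "gor C W M''"
proof -
  obtain S where S: "M \<in> S" "\<forall>N \<in> S. perp C W N \<and>
    (\<exists>N' \<in> S. syzygy C W N' N) \<and> (\<exists>N' \<in> S. syzygy C W N N')"
    using assms unfolding gor_def by blast
  then have "gor C W N" if "N \<in> S" for N using that gor_coinduct[of N S C W] by blast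
  then show ?thesis using S that by blast
qed

lemma gorI:
  assumes M: "perp C W M" "syzygy C W M' M" "gor C W M'" "syzygy C W M M''" "gor C W M''"
  shows "gor C W M"
proof (rule gor_coinduct[of _ "insert M (Collect (gor C W))"])
  fix N assume "N \<in> insert M (Collect (gor C W))"
  then consider "N = M" | "gor C W N" by auto
  then show "perp C W N \<and> (\<exists>N' \<in> insert M (Collect (gor C W)). syzygy C W N' N) \<and>
    (\<exists>N' \<in> insert M (Collect (gor C W)). syzygy C W N N')"
  proof cases
    case 1
    then show ?thesis using M by auto
  next
    case 2
    then show ?thesis by (rule gor_cases) auto
  qed
qed simp

lemma op_syzygy [simp]: "syzygy (op C) W M' M = syzygy C W M M'"
  by (auto simp: syzygy_def)

lemma (in abelian_category) op_perp [simp]: "perp (op C) W M = perp C W M"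
  by (auto simp: perp_def)

lemma (in abelian_category) op_gor [simp]: "gor (op C) W M = gor C W M"
  unfolding gor_def by (simp add: conj_commute)

text \<open>The setting is self-dual, so every lemma proved in it has a dual.\<close>

locale self_orthogonal = abelian_category C
  for C :: "('o, 'm, 'b) preadd_cat_scheme" (structure) +
  fixes W :: "'o set"
  assumes subcat: "subcategory C W"
    and orth: "\<lbrakk>V \<in> W; V' \<in> W\<rbrakk> \<Longrightarrow> ext1 C V V'"
begin

lemma op_self_orthogonal: "self_orthogonal (op C) W"
proof (intro self_orthogonal.intro self_orthogonal_axioms.intro op)
  have "\<exists>P\<in>W. \<exists>i j p q. is_biproduct C A B P p q i j" if "A \<in> W" "B \<in> W" for A B
    using subcat that unfolding subcategory_def by metis
  then show "subcategory (op C) W" using subcat by (simp add: subcategory_def)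
qed (simp add: orth)

lemma W_Obj: "V \<in> W \<Longrightarrow> V \<in> Obj C"
  using subcat by (auto simp: subcategory_def)

lemma perp_extension: "\<lbrakk>ses C A i B p D; perp C W A; perp C W D\<rbrakk> \<Longrightarrow> perp C W B"
  unfolding perp_def using ext1_extension ext1_coextension by blast

lemma perp_retract:
  "\<lbrakk>perp C W P; k \<in> Hom C K P; r \<in> Hom C P K; r \<cdot> k = Idm C K\<rbrakk> \<Longrightarrow> perp C W K"
  unfolding perp_def using ext1_retract ext1_coretract by blast

lemma gor_perp: "gor C W M \<Longrightarrow> perp C W M"
  by (erule gor_cases)

lemma gor_cover:
  assumes "gor C W M"
  obtains M' i X p where "ses C M' i X p M" "X \<in> W" "gor C W M'"
  using gor_cases[OF assms] unfolding syzygy_def by metis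

text \<open>The kernel \<open>B'\<close> is again an extension of objects in the class, which keeps the coinduction in
  \<open>gor_extension\<close> going.\<close>

lemma gor_extension_cover:
  assumes s: "ses C A j B q D" and A: "gor C W A" and D: "gor C W D"
  obtains B' k X p A' h g D' where "ses C B' k X p B" "X \<in> W"
    "ses C A' h B' g D'" "gor C W A'" "gor C W D'"
proof -
  obtain A' iA XA pA where a: "ses C A' iA XA pA A" "XA \<in> W" "gor C W A'" using gor_cover[OF A] .
  obtain D' iD XD pD where d: "ses C D' iD XD pD D" "XD \<in> W" "gor C W D'" using gor_cover[OF D] .
  obtain X i1 i2 p1 p2 where X: "X \<in> W" "is_biproduct C XA XD X i1 i2 p1 p2"
    using subcat a(2) d(2) unfolding subcategory_def by metis
  have "ext1 C XD A" using gor_perp[OF A] d(2) by (simp add: perp_def)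
  from horseshoe[OF s a(1) d(1) this X(2)] show ?thesis using that X(1) a(3) d(3) by metis
qed

lemmas gor_cocover = self_orthogonal.gor_cover[OF op_self_orthogonal, simplified]
lemmas gor_extension_cocover = self_orthogonal.gor_extension_cover[OF op_self_orthogonal, simplified]

lemma gor_extension:
  assumes "ses C A j B q D" "gor C W A" "gor C W D"
  shows "gor C W B"
proof -
  let ?S = "{B. \<exists>A j q D. ses C A j B q D \<and> gor C W A \<and> gor C W D}"
  have "B \<in> ?S" using assms by blast
  then show ?thesis
  proof (induction rule: gor_coinduct)
    case (step B)
    then obtain A j q D where gor: "ses C A j B q D" "gor C W A" "gor C W D" by blast
    have 1: "perp C W B" using perp_extension gor gor_perp by blast
    obtain B' k X p A' h g D' where 2: "ses C B' k X p B" "X \<in> W"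
      "ses C A' h B' g D'" "gor C W A'" "gor C W D'" using gor_extension_cover[OF gor] .
    obtain B'' k' X' p' A'' h' g' D'' where 3: "ses C B p' X' k' B''" "X' \<in> W"
      "ses C D'' g' B'' h' A''" "gor C W A''" "gor C W D''"
      using gor_extension_cocover[OF gor(1,3,2)] by metis
    have "B' \<in> ?S" "B'' \<in> ?S" using 2 3 by blast+
    moreover have "syzygy C W B' B" "syzygy C W B B''" using 2 3 unfolding syzygy_def by blast+
    ultimately show ?case using 1 by blast
  qed
qed

text \<open>The steps are \<open>0 \<rightarrow> 0 \<rightarrow> V \<rightarrow> V \<rightarrow> 0\<close> and \<open>0 \<rightarrow> V \<rightarrow> V \<rightarrow> 0 \<rightarrow> 0\<close>.\<close>

lemma W_gor:
  assumes "V \<in> W"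
  shows "gor C W V"
  using assms
proof (induction rule: gor_coinduct)
  case (step V)
  obtain Z where Z: "Z \<in> W" "is_zero_object C Z" using subcat by (auto simp: subcategory_def)
  have V: "V \<in> Obj C" "Z \<in> Obj C" using step Z W_Obj by auto
  have toZ: "u = v" if "u \<in> Hom C T Z" "v \<in> Hom C T Z" for u v T
    using Z(2) that Hom_Obj[OF that(1)] unfolding is_zero_object_def by metis
  have fromZ: "u = v" if "u \<in> Hom C Z T" "v \<in> Hom C Z T" for u v T
    using Z(2) that Hom_Obj[OF that(1)] unfolding is_zero_object_def by metis
  have epi: "is_epi C (Idm C V)" and mono: "is_mono C (Idm C V)"
    using V Idm_in_Hom[OF V(1)] by (auto intro!: is_epiI is_monoI simp: cat_simps)
  have z: "Zero C Z V \<in> Hom C Z V" "Zero C V Z \<in> Hom C V Z" using Zero_in_Hom V by auto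
  have 1: "ses C Z (Zero C Z V) V (Idm C V) V"
  proof (rule sesI[OF z(1) Idm_in_Hom[OF V(1)] _ _ epi])
    show "is_mono C (Zero C Z V)" using toZ Zero_in_Hom V Hom_Obj by (metis is_monoI[OF z(1)])
    fix T g assume g: "g \<in> Hom C T V" "Idm C V \<cdot> g = Zero C T V"
    then have "Zero C Z V \<cdot> Zero C T Z = g" using V Hom_Obj[OF g(1)] by (simp add: cat_simps)
    then show "\<exists>h\<in>Hom C T Z. Zero C Z V \<cdot> h = g"
      using Zero_in_Hom[OF Hom_Obj(1)[OF g(1)] V(2)] by blast
  qed (use V in \<open>simp add: cat_simps\<close>)
  have 2: "ses C V (Idm C V) V (Zero C V Z) Z"
  proof (rule sesI[OF Idm_in_Hom[OF V(1)] z(2) _ mono])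
    show "is_epi C (Zero C V Z)" using fromZ Zero_in_Hom V Hom_Obj by (metis is_epiI[OF z(2)])
    fix T g assume g: "g \<in> Hom C T V"
    then show "\<exists>h\<in>Hom C T V. Idm C V \<cdot> h = g" using Comp_Idm_left by blast
  qed (use V in \<open>simp add: cat_simps\<close>)
  have "perp C W V" using orth step by (simp add: perp_def)
  then show ?case using 1 2 step Z(1) unfolding syzygy_def by blast
qed

section \<open>Kernels of epimorphisms\<close>

text \<open>The splitting of \<open>P \<rightarrow> X\<close> is what makes \<open>K\<close> orthogonal to \<open>W\<close>: the long exact sequences alone would
  compare \<open>Ext\<^sup>1(V, K)\<close> with the cokernel of \<open>Hom(V, M) \<rightarrow> Hom(V, N)\<close>, which has no reason to vanish
  without the closure hypothesis.\<close>

lemma gor_kernel_of_epi: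
  assumes closed: "closed_under_kernels_of_epis C W"
    and s: "ses C K k M f N" and M: "gor C W M" and N: "gor C W N"
  shows "gor C W K"
proof -
  obtain N' \<iota> X \<pi> where n: "ses C N' \<iota> X \<pi> N" "X \<in> W" "gor C W N'" using gor_cover[OF N] .
  obtain P a b where pb: "is_pullback f \<pi> P a b" "is_epi C b" "is_epi C a"
    using pullback_exists[OF sesD(2)[OF s] sesD(2)[OF n(1)]] ses_epi[OF s] ses_epi[OF n(1)] by metis
  obtain \<kappa> where k1: "ses C N' \<kappa> P a M" using pullback_ses[OF n(1) pb(1) sesD(2)[OF s] pb(3)] .
  obtain \<kappa>' where k2: "ses C K \<kappa>' P b X"
    using pullback_ses[OF s pullback_commute[OF pb(1)] sesD(2)[OF n(1)] pb(2)] .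
  have P: "gor C W P" using gor_extension[OF k1 n(3) M] .
  obtain P' c Y \<rho> where y: "ses C P' c Y \<rho> P" "Y \<in> W" "gor C W P'" using gor_cover[OF P] .
  obtain P'' d Z t where z: "ses C P t Z d P''" "Z \<in> W" "gor C W P''" using gor_cocover[OF P] by metis
  note K2 = sesD[OF k2] and Y = sesD[OF y(1)] and Z = sesD[OF z(1)]
  have br: "b \<cdot> \<rho> \<in> Hom C Y X" using Comp_in_Hom[OF Y(2) K2(2)] .
  have bre: "is_epi C (b \<cdot> \<rho>)" using is_epi_Comp[OF K2(2) Y(2) ses_epi[OF k2] ses_epi[OF y(1)]] .
  obtain L l where l: "ses C L l Y (b \<cdot> \<rho>) X" using epi_ses[OF bre br] .
  (* the only use of the closure hypothesis on W *)
  have "Dom C l \<in> W"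
    using closed bre br l y(2) n(2) unfolding closed_under_kernels_of_epis_def ses_def
    by (metis Hom_Dom Hom_Cod)
  then have L: "L \<in> W" using sesD(1)[OF l] by (simp add: Hom_def)
  (* Ext(X, L) = 0 splits Y -> X, hence also P -> X *)
  obtain \<sigma> where sg: "\<sigma> \<in> Hom C X Y" "(b \<cdot> \<rho>) \<cdot> \<sigma> = Idm C X"
    using ext1_lift[OF orth[OF n(2) L] l Idm_in_Hom[OF K2(6)]] .
  have "b \<cdot> (\<rho> \<cdot> \<sigma>) = Idm C X" using Comp_assoc[OF sg(1) Y(2) K2(2)] sg(2) by simp
  then obtain r where r: "r \<in> Hom C P K" "r \<cdot> \<kappa>' = Idm C K"
    using retraction_of_section[OF k2 Comp_in_Hom[OF sg(1) Y(2)]] by blast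
  have perpK: "perp C W K" using perp_retract[OF gor_perp[OF P] K2(1) r] .
  obtain h g where hg: "ses C P' h L g K" using ses_kernel_of_Comp[OF y(1) k2 l] .
  have tk: "t \<cdot> \<kappa>' \<in> Hom C K Z" using Comp_in_Hom[OF K2(1) Z(1)] .
  have tkm: "is_mono C (t \<cdot> \<kappa>')" using is_mono_Comp[OF K2(1) Z(1) ses_mono[OF k2] ses_mono[OF z(1)]] .
  obtain Q q where q: "ses C K (t \<cdot> \<kappa>') Z q Q" using mono_ses[OF tkm tk] by metis
  obtain h' g' where "ses C X g' Q h' P''" using ses_cokernel_of_Comp[OF z(1) k2 q] by metis
  then have Q: "gor C W Q" using gor_extension W_gor[OF n(2)] z(3) by blast
  show ?thesis using gorI[OF perpK _ y(3) _ Q] hg L q z(2) unfolding syzygy_def by blast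
qed

lemma op_closed [simp]:
  "closed_under_kernels_of_epis (op C) W = closed_under_cokernels_of_monos C W"
  by (auto simp: closed_under_kernels_of_epis_def closed_under_cokernels_of_monos_def)

lemmas gor_cokernel_of_mono = self_orthogonal.gor_kernel_of_epi[OF op_self_orthogonal, simplified]
end

section \<open>Gorenstein objects and totally acyclic complexes\<close>

lemma exact_seq_iff_kernel_image:
  assumes "group K" "group G" "group H" "g \<in> hom K G" "h \<in> hom G H"
  shows "exact_seq ([H, G, K], [h, g]) \<longleftrightarrow> kernel G H h = g ` carrier K"
  using assms by (auto simp: group_hom_def group_hom_axioms_def)

context preadditive_category
begin

lemma Hom_into_exact_iff:
  assumes X: "is_complex C X d" and V: "V \<in> Obj C"
  shows "Hom_into_exact C V X d \<longleftrightarrow>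
    (\<forall>n. \<forall>f \<in> Hom C V (X n). d n \<cdot> f = Zero C V (X (n - 1)) \<longrightarrow>
      (\<exists>g \<in> Hom C V (X (n + 1)). d (n + 1) \<cdot> g = f))"
proof -
  have dH: "d n \<in> Hom C (X n) (X (n - 1))" "X n \<in> Obj C"
    "d n \<cdot> d (n + 1) = Zero C (X (n + 1)) (X (n - 1))" for n
    using X by (auto simp: is_complex_def)
  have g: "group (hom_group C V (X n))" for n
    using comm_group_Hom[OF V dH(2)] by (simp add: comm_group_def)
  have h: "(\<lambda>f. d n \<cdot> f) \<in> hom (hom_group C V (X n)) (hom_group C V (X (n - 1)))" for n
    using dH(1)[of n] by (auto simp: hom_def hom_group_def Comp_in_Hom Comp_Add_right)
  have h': "(\<lambda>f. d (n + 1) \<cdot> f) \<in> hom (hom_group C V (X (n + 1))) (hom_group C V (X n))" for n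
    using h[of "n + 1"] by simp
  have sub: "d (n + 1) \<cdot> f \<in> Hom C V (X n) \<and> d n \<cdot> (d (n + 1) \<cdot> f) = Zero C V (X (n - 1))"
    if "f \<in> Hom C V (X (n + 1))" for f n
    using Comp_assoc[OF that, of "d (n + 1)" "X n" "d n" "X (n - 1)"] that dH(1)[of "n + 1"] dH(1)[of n]
      dH(3)[of n] Comp_in_Hom[OF that, of "d (n + 1)" "X n"] dH(2)
    by (simp add: Comp_Zero Hom_def)
  show ?thesis
    unfolding Hom_into_exact_def exact_seq_iff_kernel_image[OF g g g h' h]
  proof (rule iff_allI)
    fix n
    show "kernel (hom_group C V (X n)) (hom_group C V (X (n - 1))) (\<lambda>f. d n \<cdot> f) =
        (\<lambda>f. d (n + 1) \<cdot> f) ` carrier (hom_group C V (X (n + 1))) \<longleftrightarrow>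
      (\<forall>f \<in> Hom C V (X n). d n \<cdot> f = Zero C V (X (n - 1)) \<longrightarrow>
        (\<exists>g \<in> Hom C V (X (n + 1)). d (n + 1) \<cdot> g = f))"
      using sub[of _ n] by (auto simp: kernel_def hom_group_def image_iff set_eq_iff) metis+
  qed
qed

lemma Hom_from_exact_iff:
  assumes X: "is_complex C X d" and V: "V \<in> Obj C"
  shows "Hom_from_exact C X d V \<longleftrightarrow>
    (\<forall>n. \<forall>f \<in> Hom C (X n) V. f \<cdot> d (n + 1) = Zero C (X (n + 1)) V \<longrightarrow>
      (\<exists>g \<in> Hom C (X (n - 1)) V. g \<cdot> d n = f))"
proof -
  have dH: "d n \<in> Hom C (X n) (X (n - 1))" "X n \<in> Obj C"
    "d n \<cdot> d (n + 1) = Zero C (X (n + 1)) (X (n - 1))" for n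
    using X by (auto simp: is_complex_def)
  have g: "group (hom_group C (X n) V)" for n
    using comm_group_Hom[OF dH(2) V] by (simp add: comm_group_def)
  have h: "(\<lambda>f. f \<cdot> d n) \<in> hom (hom_group C (X (n - 1)) V) (hom_group C (X n) V)" for n
    using dH(1)[of n] by (auto simp: hom_def hom_group_def intro: Comp_in_Hom Comp_Add_left)
  have h': "(\<lambda>f. f \<cdot> d (n + 1)) \<in> hom (hom_group C (X n) V) (hom_group C (X (n + 1)) V)" for n
    using h[of "n + 1"] by simp
  have sub: "f \<cdot> d n \<in> Hom C (X n) V \<and> (f \<cdot> d n) \<cdot> d (n + 1) = Zero C (X (n + 1)) V"
    if "f \<in> Hom C (X (n - 1)) V" for f n
    using Comp_assoc[of "d (n + 1)" "X (n + 1)" "X n" "d n" "X (n - 1)" f V] that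
      dH(1)[of "n + 1"] dH(1)[of n] dH(3)[of n] Comp_in_Hom[of "d n" "X n" "X (n - 1)" f V] dH(2)
    by (simp add: Comp_Zero Hom_def)
  show ?thesis
    unfolding Hom_from_exact_def exact_seq_iff_kernel_image[OF g g g h h']
  proof (rule iff_allI)
    fix n
    show "kernel (hom_group C (X n) V) (hom_group C (X (n + 1)) V) (\<lambda>f. f \<cdot> d (n + 1)) =
        (\<lambda>f. f \<cdot> d n) ` carrier (hom_group C (X (n - 1)) V) \<longleftrightarrow>
      (\<forall>f \<in> Hom C (X n) V. f \<cdot> d (n + 1) = Zero C (X (n + 1)) V \<longrightarrow>
        (\<exists>g \<in> Hom C (X (n - 1)) V. g \<cdot> d n = f))"
      using sub[of _ n] by (auto simp: kernel_def hom_group_def image_iff set_eq_iff) metis+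
  qed
qed

end

context self_orthogonal
begin

text \<open>A map \<open>V \<rightarrow> X\<^sub>n\<close> killed by the differential factors through \<open>M\<^sub>n\<^sub>+\<^sub>1\<close> and lifts to \<open>X\<^sub>n\<^sub>+\<^sub>1\<close> because
  \<open>Ext\<^sup>1(V, M\<^sub>n\<^sub>+\<^sub>2) = 0\<close>; dually for maps out of the complex.\<close>

lemma totally_acyclic_splice:
  fixes m x :: "int \<Rightarrow> 'o" and i p :: "int \<Rightarrow> 'm"
  assumes s: "\<And>n. ses C (m (n + 1)) (i n) (x n) (p n) (m n)"
    and x: "\<And>n. x n \<in> W" and perp: "\<And>n. perp C W (m n)"
  shows "totally_acyclic C W x (\<lambda>n. i (n - 1) \<cdot> p n)"
    and "is_cokernel C (i 0 \<cdot> p 1) (p 0)"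
proof -
  define d where "d n = i (n - 1) \<cdot> p n" for n
  have iH: "i n \<in> Hom C (m (n + 1)) (x n)" and pH: "p n \<in> Hom C (x n) (m n)"
    and mo: "is_mono C (i n)" and ep: "is_epi C (p n)" and pi: "p n \<cdot> i n = Zero C (m (n + 1)) (m n)"
    and ob: "x n \<in> Obj C" "m n \<in> Obj C" for n
    using s[of n] sesD ses_mono ses_epi by auto
  have iH': "i (n - 1) \<in> Hom C (m n) (x (n - 1))" for n using iH[of "n - 1"] by simp
  have dH: "d n \<in> Hom C (x n) (x (n - 1))" for n
    unfolding d_def using Comp_in_Hom[OF pH iH'] .
  have d1: "d (n + 1) = i n \<cdot> p (n + 1)" for n by (simp add: d_def)
  have d_left: "d n \<cdot> f = i (n - 1) \<cdot> (p n \<cdot> f)" if "f \<in> Hom C T (x n)" for f n T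
    unfolding d_def using Comp_assoc[OF that pH iH'] .
  have d_right: "f \<cdot> d (n + 1) = (f \<cdot> i n) \<cdot> p (n + 1)" if "f \<in> Hom C (x n) T" for f n T
    unfolding d1 using Comp_assoc[OF pH iH that] by simp
  have dd: "d n \<cdot> d (n + 1) = Zero C (x (n + 1)) (x (n - 1))" for n
  proof -
    have "p n \<cdot> d (n + 1) = Zero C (x (n + 1)) (m n)"
      unfolding d_right[OF pH] pi using pH[of "n + 1"] ob by (simp add: cat_simps)
    moreover have "d (n + 1) \<in> Hom C (x (n + 1)) (x n)" using dH[of "n + 1"] by simp
    ultimately show ?thesis using d_left iH'[of n] ob by (simp add: cat_simps)
  qed
  have cx: "is_complex C x d" using dH dd ob by (simp add: is_complex_def)
  have cok: "is_cokernel C (d (n + 1)) (p n)" for n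
  proof (rule is_cokernelI[OF pH _ _ ep])
    show "d (n + 1) \<in> Hom C (x (n + 1)) (x n)" using dH[of "n + 1"] by simp
    show "p n \<cdot> d (n + 1) = Zero C (x (n + 1)) (m n)"
      unfolding d_right[OF pH] pi using pH[of "n + 1"] ob by (simp add: cat_simps)
    fix T u assume u: "u \<in> Hom C (x n) T" "u \<cdot> d (n + 1) = Zero C (x (n + 1)) T"
    have "u \<cdot> i n = Zero C (m (n + 1)) T"
      using is_epi_Zero[OF ep pH Comp_in_Hom[OF iH u(1)]] u(2) d_right[OF u(1)] by simp
    then show "\<exists>h\<in>Hom C (m n) T. h \<cdot> p n = u" using ses_colift[OF s u(1)] by metis
  qed
  have ker: "is_kernel C (d n) (i n)" for n
  proof (rule is_kernelI[OF iH dH _ mo])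
    show "d n \<cdot> i n = Zero C (m (n + 1)) (x (n - 1))"
      unfolding d_left[OF iH] pi using iH'[of n] ob by (simp add: cat_simps)
    fix T u assume u: "u \<in> Hom C T (x n)" "d n \<cdot> u = Zero C T (x (n - 1))"
    have "p n \<cdot> u = Zero C T (m n)"
      using is_mono_Zero[OF mo iH' Comp_in_Hom[OF u(1) pH]] u(2) d_left[OF u(1)] by simp
    then show "\<exists>h\<in>Hom C T (m (n + 1)). i n \<cdot> h = u" using ses_lift[OF s u(1)] by metis
  qed
  have "exact_at C (d (n + 1)) (d n)" for n
    using cok[of n] ker[of n] s[of n] unfolding exact_at_def ses_def by blast
  then have ex: "exact_complex C x d" using cx by (simp add: exact_complex_def)
  have "Hom_into_exact C V x d" if V: "V \<in> W" for V
    unfolding Hom_into_exact_iff[OF cx W_Obj[OF V]]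
  proof (intro allI ballI impI)
    fix n f assume f: "f \<in> Hom C V (x n)" "d n \<cdot> f = Zero C V (x (n - 1))"
    obtain g where g: "g \<in> Hom C V (m (n + 1))" "i n \<cdot> g = f"
      using is_kernel_lift[OF ker dH f] Hom_Dom[OF iH] by metis
    have "ext1 C V (m (n + 1 + 1))" using perp V by (simp add: perp_def)
    from ext1_lift[OF this s g(1)] obtain h where h: "h \<in> Hom C V (x (n + 1))" "p (n + 1) \<cdot> h = g" .
    have "d (n + 1) \<cdot> h = f" using d_left[OF h(1)] h(2) g(2) by simp
    then show "\<exists>g\<in>Hom C V (x (n + 1)). d (n + 1) \<cdot> g = f" using h(1) by blast
  qed
  moreover have "Hom_from_exact C x d V" if V: "V \<in> W" for V
    unfolding Hom_from_exact_iff[OF cx W_Obj[OF V]]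
  proof (intro allI ballI impI)
    fix n f assume f: "f \<in> Hom C (x n) V" "f \<cdot> d (n + 1) = Zero C (x (n + 1)) V"
    have d': "d (n + 1) \<in> Hom C (x (n + 1)) (x n)" using dH[of "n + 1"] by simp
    obtain g where g: "g \<in> Hom C (m n) V" "g \<cdot> p n = f"
      using is_cokernel_colift[OF cok d' f] Hom_Cod[OF pH] by metis
    have "ext1 C (m (n - 1)) V" using perp V by (simp add: perp_def)
    moreover have "ses C (m n) (i (n - 1)) (x (n - 1)) (p (n - 1)) (m (n - 1))" using s[of "n - 1"] by simp
    ultimately obtain h where h: "h \<in> Hom C (x (n - 1)) V" "h \<cdot> i (n - 1) = g"
      using ext1_extend g(1) by metis
    have "h \<cdot> d n = f" using d_right[of h "n - 1" V] h g(2) by simp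
    then show "\<exists>g\<in>Hom C (x (n - 1)) V. g \<cdot> d n = f" using h(1) by blast
  qed
  ultimately have "totally_acyclic C W x d" using ex x by (simp add: totally_acyclic_def)
  then show "totally_acyclic C W x (\<lambda>n. i (n - 1) \<cdot> p n)" unfolding d_def .
  show "is_cokernel C (i 0 \<cdot> p 1) (p 0)" using cok[of 0] d1[of 0] by simp
qed

text \<open>Take \<open>M\<^sub>n\<close> to be the cokernel of \<open>d\<^sub>n\<^sub>+\<^sub>1\<close>, which is the image of \<open>d\<^sub>n\<close>. Exactness of \<open>Hom(V, X)\<close> lifts
  every map \<open>V \<rightarrow> M\<^sub>n\<^sub>-\<^sub>1\<close> to \<open>X\<^sub>n\<^sub>-\<^sub>1\<close>, so \<open>Ext\<^sup>1(V, X\<^sub>n\<^sub>-\<^sub>1) = 0\<close> gives \<open>Ext\<^sup>1(V, M\<^sub>n) = 0\<close>; dually on the other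
  side. The cokernel in degree \<open>0\<close> is the prescribed one, which makes \<open>M\<^sub>0\<close> a given object and not
  merely an isomorphic copy of it.\<close>

lemma totally_acyclic_unsplice:
  assumes X: "totally_acyclic C W X d" and p: "is_cokernel C (d 1) p"
  obtains m i q where "\<forall>n. ses C (m (n + 1)) (i n) (X n) (q n) (m n)" "\<forall>n. perp C W (m n)"
    "m 0 = Cod C p"
proof -
  from X have cx: "is_complex C X d" and ex: "exact_at C (d (n + 1)) (d n)" and XW: "X n \<in> W" for n
    by (auto simp: totally_acyclic_def exact_complex_def)
  have dH: "d n \<in> Hom C (X n) (X (n - 1))" and XO: "X n \<in> Obj C"
    and dd: "d n \<cdot> d (n + 1) = Zero C (X (n + 1)) (X (n - 1))" for n
    using cx by (auto simp: is_complex_def)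
  have dH': "d (n + 1) \<in> Hom C (X (n + 1)) (X n)" for n using dH[of "n + 1"] by simp
  have "\<forall>n. \<exists>c. is_cokernel C (d (n + 1)) c" using cokernel_exists dH Hom_Arr by blast
  then obtain c where c: "is_cokernel C (d (n + 1)) (c n)" for n by metis
  define q where "q = c(0 := p)"
  have q: "is_cokernel C (d (n + 1)) (q n)" for n using c p by (simp add: q_def)
  define m where "m n = Cod C (q n)" for n
  have qH: "q n \<in> Hom C (X n) (m n)" for n
    using q[of n] dH'[of n] by (auto simp: is_cokernel_def Hom_def m_def)
  have "\<forall>n. \<exists>e. e \<in> Hom C (m n) (X (n - 1)) \<and> e \<cdot> q n = d n"
    using is_cokernel_colift[OF q dH' dH dd] unfolding m_def by metis
  then obtain e where e: "e n \<in> Hom C (m n) (X (n - 1))" "e n \<cdot> q n = d n" for n by metis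
  have mo: "is_mono C (e n)" for n
    using exact_at_image_mono[OF ex q dH] e[of n] by (simp add: m_def)
  have e': "e (n + 1) \<in> Hom C (m (n + 1)) (X n)" for n using e(1)[of "n + 1"] by simp
  have ep: "is_epi C (q n)" for n using is_cokernel_epi[OF q] .
  have d_right: "f \<cdot> d (n + 1) = (f \<cdot> e (n + 1)) \<cdot> q (n + 1)" if "f \<in> Hom C (X n) T" for f n T
    using Comp_assoc[OF qH e' that] e(2) by simp
  have "is_cokernel C (e (n + 1)) (q n)" for n
  proof (rule is_cokernelI[OF qH e' _ ep])
    have "q n \<cdot> d (n + 1) = Zero C (X (n + 1)) (m n)"
      using q[of n] dH'[of n] by (simp add: is_cokernel_def Hom_def m_def)
    then show "q n \<cdot> e (n + 1) = Zero C (m (n + 1)) (m n)"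
      using is_epi_Zero[OF ep qH Comp_in_Hom[OF e' qH]] d_right[OF qH] by simp
    fix T u assume u: "u \<in> Hom C (X n) T" "u \<cdot> e (n + 1) = Zero C (m (n + 1)) T"
    then have "u \<cdot> d (n + 1) = Zero C (X (n + 1)) T"
      unfolding d_right[OF u(1)] using qH[of "n + 1"] Hom_Obj[OF u(1)] by (simp add: cat_simps)
    from is_cokernel_colift[OF q dH' u(1) this] show "\<exists>h\<in>Hom C (m n) T. h \<cdot> q n = u"
      unfolding m_def by blast
  qed
  then have s: "ses C (m (n + 1)) (e (n + 1)) (X n) (q n) (m n)" for n
    using ses_mono_cokernel[OF mo, of "n + 1" "q n"] e'[of n] by (simp add: Hom_def m_def)
  have "perp C W (m n)" for n
    unfolding perp_def
  proof (intro ballI conjI)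
    fix V assume V: "V \<in> W"
    have into: "\<And>n f. f \<in> Hom C V (X n) \<Longrightarrow> d n \<cdot> f = Zero C V (X (n - 1)) \<Longrightarrow>
        \<exists>g \<in> Hom C V (X (n + 1)). d (n + 1) \<cdot> g = f"
      and "from": "\<And>n f. f \<in> Hom C (X n) V \<Longrightarrow> f \<cdot> d (n + 1) = Zero C (X (n + 1)) V \<Longrightarrow>
        \<exists>g \<in> Hom C (X (n - 1)) V. g \<cdot> d n = f"
      using X V Hom_into_exact_iff[OF cx W_Obj[OF V]] Hom_from_exact_iff[OF cx W_Obj[OF V]]
      unfolding totally_acyclic_def by blast+
    have sn: "ses C (m n) (e n) (X (n - 1)) (q (n - 1)) (m (n - 1))" using s[of "n - 1"] by simp
    show "ext1 C V (m n)"
    proof (rule ext1_by_lifting[OF sn orth[OF V XW]])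
      fix f assume f: "f \<in> Hom C V (m (n - 1))"
      define k where "k = n - 1 - 1"
      have ek: "e (k + 1) \<in> Hom C (m (n - 1)) (X k)" and qk: "q (k + 1) \<in> Hom C (X (n - 1)) (m (n - 1))"
        and nk: "k + 1 = n - 1"
        using e'[of k] qH[of "k + 1"] by (simp_all add: k_def)
      have ef: "e (k + 1) \<cdot> f \<in> Hom C V (X k)" using Comp_in_Hom[OF f ek] .
      have "q k \<cdot> e (k + 1) = Zero C (m (k + 1)) (m k)" using sesD(3)[OF s] .
      then have "d k \<cdot> e (k + 1) = Zero C (m (n - 1)) (X (k - 1))"
        using Comp_assoc[OF ek qH e(1)[of k]] e(2)[of k] e(1)[of k] Hom_Obj(1)[OF ek]
        unfolding nk by (simp add: cat_simps)
      then have "d k \<cdot> (e (k + 1) \<cdot> f) = Zero C V (X (k - 1))"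
        using Comp_assoc[OF f ek dH] f XO by (simp add: cat_simps)
      from into[OF ef this] obtain g where g: "g \<in> Hom C V (X (n - 1))" "d (k + 1) \<cdot> g = e (k + 1) \<cdot> f"
        unfolding nk by blast
      have "e (k + 1) \<cdot> (q (k + 1) \<cdot> g) = e (k + 1) \<cdot> f"
        using Comp_assoc[OF g(1) qk ek] e(2)[of "k + 1"] g(2) by simp
      then have "q (k + 1) \<cdot> g = f"
        using is_mono_cancel[OF mo ek Comp_in_Hom[OF g(1) qk] f] by simp
      then show "\<exists>g\<in>Hom C V (X (n - 1)). q (n - 1) \<cdot> g = f" using g(1) nk by auto
    qed
    show "ext1 C (m n) V"
    proof (rule ext1_by_extending[OF s orth[OF XW V]])
      fix f assume f: "f \<in> Hom C (m (n + 1)) V"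
      let ?k = "n + 1"
      have fq: "f \<cdot> q ?k \<in> Hom C (X ?k) V" using Comp_in_Hom[OF qH f] .
      have "q ?k \<cdot> d (?k + 1) = Zero C (X (?k + 1)) (m ?k)"
        using q[of ?k] dH'[of ?k] by (simp add: is_cokernel_def Hom_def m_def)
      then have "(f \<cdot> q ?k) \<cdot> d (?k + 1) = Zero C (X (?k + 1)) V"
        using Comp_assoc[OF dH' qH f] f XO by (simp add: cat_simps)
      from "from"[OF fq this] obtain g where g: "g \<in> Hom C (X n) V" "g \<cdot> d ?k = f \<cdot> q ?k" by auto
      have "g \<cdot> e ?k = f"
        using is_epi_cancel[OF ep qH Comp_in_Hom[OF e' g(1)] f] d_right[OF g(1)] g(2) by simp
      then show "\<exists>g\<in>Hom C (X n) V. g \<cdot> e (n + 1) = f" using g(1) by blast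
    qed
  qed
  then show ?thesis using that[of m "\<lambda>n. e (n + 1)" q] s by (simp add: q_def m_def)
qed

text \<open>Composing the given isomorphism into the cokernel map makes \<open>M\<close> itself a cokernel of \<open>d\<^sub>1\<close>.\<close>

lemma gor_if_Gorenstein:
  assumes "M \<in> Gorenstein C W"
  shows "gor C W M"
proof -
  obtain X d p where X: "totally_acyclic C W X d" "is_cokernel C (d 1) p" "isomorphic C M (Cod C p)"
    using assms by (auto simp: Gorenstein_def)
  have d: "d 1 \<in> Hom C (X 1) (X 0)"
    using X(1) by (auto simp: totally_acyclic_def exact_complex_def is_complex_def dest!: spec[of _ 1])
  obtain g f where gf: "g \<in> Hom C M (Cod C p)" "f \<in> Hom C (Cod C p) M" "g \<cdot> f = Idm C (Cod C p)"
    "f \<cdot> g = Idm C M" using X(3) by (auto simp: isomorphic_def)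
  have c: "is_cokernel C (d 1) (f \<cdot> p)"
    by (rule cokernel_iso[OF X(2) d gf(2,1,3,4)])
  have "p \<in> Arr C" using X(2) by (simp add: is_cokernel_def)
  then have cod: "Cod C (f \<cdot> p) = M"
    using Arr_Comp(3)[of p f] gf(2) by (simp add: Hom_def)
  obtain m i q where m: "\<forall>n. ses C (m (n + 1)) (i n) (X n) (q n) (m n)" "\<forall>n. perp C W (m n)"
    "m 0 = Cod C (f \<cdot> p)"
    using totally_acyclic_unsplice[OF X(1) c] .
  have XW: "X n \<in> W" for n using X(1) by (simp add: totally_acyclic_def)
  have "M \<in> range m" using m(3) cod by (metis rangeI)
  then show ?thesis
  proof (induction rule: gor_coinduct)
    case (step N)
    then obtain n where N: "N = m n" by blast
    have "ses C (m n) (i (n - 1)) (X (n - 1)) (q (n - 1)) (m (n - 1))"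
      using m(1)[rule_format, of "n - 1"] by simp
    then have "syzygy C W (m n) (m (n - 1))" "syzygy C W (m (n + 1)) (m n)"
      using m(1) XW unfolding syzygy_def by blast+
    then show ?case using m(2) unfolding N by blast
  qed
qed

text \<open>Iterate a choice of left steps in the degrees \<open>n \<ge> 0\<close> and a choice of right steps in the
  negative degrees.\<close>

lemma Gorenstein_if_gor:
  assumes M: "gor C W M"
  shows "M \<in> Gorenstein C W"
proof -
  have "\<forall>M. \<exists>M' i X p. gor C W M \<longrightarrow> ses C M' i X p M \<and> X \<in> W \<and> gor C W M'"
    using gor_cover by metis
  then obtain lm li lx lp where
    l: "\<And>M. gor C W M \<Longrightarrow> ses C (lm M) (li M) (lx M) (lp M) M \<and> lx M \<in> W \<and> gor C W (lm M)"
    by metis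
  have "\<forall>M. \<exists>M' i X p. gor C W M \<longrightarrow> ses C M i X p M' \<and> X \<in> W \<and> gor C W M'"
    using gor_cocover by metis
  then obtain rm ri rx rp where
    r: "\<And>M. gor C W M \<Longrightarrow> ses C M (ri M) (rx M) (rp M) (rm M) \<and> rx M \<in> W \<and> gor C W (rm M)"
    by metis
  define m where "m n = (if n \<ge> 0 then (lm ^^ nat n) M else (rm ^^ nat (- n)) M)" for n :: int
  define x where "x n = (if n \<ge> 0 then lx (m n) else rx (m (n + 1)))" for n
  define i where "i n = (if n \<ge> 0 then li (m n) else ri (m (n + 1)))" for n
  define p where "p n = (if n \<ge> 0 then lp (m n) else rp (m (n + 1)))" for n
  have "gor C W ((lm ^^ k) M)" "gor C W ((rm ^^ k) M)" for k
    using M l r by (induction k) auto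
  then have gm: "gor C W (m n)" for n by (simp add: m_def)
  have up: "m (n + 1) = lm (m n)" if "n \<ge> 0" for n
    using that by (simp add: m_def nat_add_distrib)
  have down: "m n = rm (m (n + 1))" if "n < 0" for n
  proof -
    have "nat (- n) = Suc (nat (- (n + 1)))" using that by simp
    then show ?thesis using that by (auto simp: m_def)
  qed
  have s: "ses C (m (n + 1)) (i n) (x n) (p n) (m n)" and xW: "x n \<in> W" for n
    using l[OF gm[of n]] r[OF gm[of "n + 1"]] up[of n] down[of n]
    by (auto simp: x_def i_def p_def not_le)
  have T: "totally_acyclic C W x (\<lambda>n. i (n - 1) \<cdot> p n)" "is_cokernel C (i 0 \<cdot> p 1) (p 0)"
    using totally_acyclic_splice[of m i x p] s xW gor_perp[OF gm] by blast+
  have MO: "M \<in> Obj C" using sesD(6)[OF s[of 0]] by (simp add: m_def)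
  have "Cod C (p 0) = M" using sesD(2)[OF s[of 0]] by (simp add: Hom_def m_def)
  moreover have "isomorphic C M M"
    using MO Idm_in_Hom[OF MO] Comp_Idm_left[OF Idm_in_Hom[OF MO]] by (auto simp: isomorphic_def)
  ultimately have "is_cokernel C ((\<lambda>n. i (n - 1) \<cdot> p n) 1) (p 0)" "isomorphic C M (Cod C (p 0))"
    using T(2) by simp_all
  with T(1) MO show ?thesis unfolding Gorenstein_def by blast
qed

lemma Gorenstein_eq: "M \<in> Gorenstein C W \<longleftrightarrow> gor C W M"
  using gor_if_Gorenstein Gorenstein_if_gor by blast

lemma Gorenstein_closed_kernels:
  assumes "closed_under_kernels_of_epis C W"
  shows "closed_under_kernels_of_epis C (Gorenstein C W)"
  unfolding closed_under_kernels_of_epis_def Gorenstein_eq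
  using ses_epi_kernel gor_kernel_of_epi[OF assms] by blast

lemma Gorenstein_closed_cokernels:
  assumes "closed_under_cokernels_of_monos C W"
  shows "closed_under_cokernels_of_monos C (Gorenstein C W)"
  unfolding closed_under_cokernels_of_monos_def Gorenstein_eq
  using ses_mono_cokernel gor_cokernel_of_mono[OF assms] by blast

end

theorem theorem4p12:
  fixes C :: "('o, 'm, 'b) preadd_cat_scheme" and W :: "'o set"
  assumes "abelian_category C"
    and "subcategory C W"
    and "Ext_orthogonal C W W"
  shows "(closed_under_kernels_of_epis C W \<longrightarrow>
            closed_under_kernels_of_epis C (Gorenstein C W)) \<and>
         (closed_under_cokernels_of_monos C W \<longrightarrow>
            closed_under_cokernels_of_monos C (Gorenstein C W))"
proof -
  interpret abelian_category C by fact
  interpret self_orthogonal C W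
  proof (intro self_orthogonal.intro self_orthogonal_axioms.intro assms(1,2))
    fix V V' assume V: "V \<in> W" "V' \<in> W"
    then have "Ext_vanishes C 1 V V'" using assms(3) by (simp add: Ext_orthogonal_def)
    moreover have "V \<in> Obj C" "V' \<in> Obj C" using V assms(2) by (auto simp: subcategory_def)
    ultimately show "ext1 C V V'" by (rule ext1_if_Ext_vanishes)
  qed
  show ?thesis using Gorenstein_closed_kernels Gorenstein_closed_cokernels by blast
qed

end
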